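(* Let $R$ be an expansive real $d\times d$ matrix and let $B,L\subset\mathbb{R}^d$ be finite sets with $N:=\#B=\#L$, such that $R^n b\cdot l\in\mathbb{Z}$ for all $n\in\mathbb{N}=\{1,2,3,\dots\}$, $b\in B$, $l\in L$, and such that the $N\times N$ matrix $H_{B,L}:=N^{-1/2}\left(e^{i2\pi b\cdot l}\right)_{b\in B,\,l\in L}$ is unitary. For $r\in\mathbb{N}$ let $$\mathcal{L}_r:=\left\{\sum_{k=0}^{n}(rR^* )^k l_k: n\in\mathbb{N},\ l_k\in L\right\}$$ and let $\mu_r$ be the probability measure on $\mathbb{R}^d$ solving $\mu_r=N^{-1}\sum_{b\in B}\mu_r\circ\sigma_{r,b}^{-1}$, where $\sigma_{r,b}(x):=(rR)^{-1}x+b$. If $L$ spans $\mathbb{R}^d$ and $0\in L$, then there exists $r_0\in\mathbb{N}$ such that for all $r\ge r_0$ the set $\{e_\lambda:\lambda\in\mathcal{L}_r\}$ is an orthonormal basis for $L^2(\mu_r)$.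
   Context: A matrix is expansive if all its eigenvalues have absolute value greater than $1$. $R^*$ is the transpose of $R$. Write $e_\lambda(x):=e^{i2\pi\lambda\cdot x}$. The probability measure $\mu_r$ solving the stated equation is unique. *)

theory Defs
  imports "HOL-Probability.Probability"
begin

(* The class instance of (^) on real^'n^'n is componentwise, hence a separate matrix power. *)
primrec matpow :: "real^'n^'n \<Rightarrow> nat \<Rightarrow> real^'n^'n" where
  "matpow A 0 = mat 1"
| "matpow A (Suc n) = A ** matpow A n"

(* Complex eigenvalues of a real matrix. *)
definition is_eigenvalue :: "real^'n^'n \<Rightarrow> complex \<Rightarrow> bool" where
  "is_eigenvalue A z \<longleftrightarrow>
     (\<exists>v :: complex^'n. v \<noteq> 0 \<and> map_matrix complex_of_real A *v v = z *s v)"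

definition expansive :: "real^'n^'n \<Rightarrow> bool" where
  "expansive A \<longleftrightarrow> (\<forall>z. is_eigenvalue A z \<longrightarrow> cmod z > 1)"

(* Unitarity of the matrix (U i j) with rows indexed by I and columns by J, i.e.
   U U* = 1 and U* U = 1; meaningful for finite I and J. *)
definition unitary_on :: "'i set \<Rightarrow> 'j set \<Rightarrow> ('i \<Rightarrow> 'j \<Rightarrow> complex) \<Rightarrow> bool" where
  "unitary_on I J U \<longleftrightarrow>
     (\<forall>i\<in>I. \<forall>i'\<in>I. (\<Sum>j\<in>J. U i j * cnj (U i' j)) = (if i = i' then 1 else 0)) \<and>
     (\<forall>j\<in>J. \<forall>j'\<in>J. (\<Sum>i\<in>I. cnj (U i j) * U i j') = (if j = j' then 1 else 0))"

definition expo :: "real^'n \<Rightarrow> real^'n \<Rightarrow> complex" where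
  "expo l x = exp (\<i> * complex_of_real (2 * pi * (l \<bullet> x)))"

definition hadamard :: "(real^'n) set \<Rightarrow> real^'n \<Rightarrow> real^'n \<Rightarrow> complex" where
  "hadamard B b l =
     complex_of_real (1 / sqrt (real (card B))) * exp (\<i> * complex_of_real (2 * pi * (b \<bullet> l)))"

definition sigma :: "real^'n^'n \<Rightarrow> nat \<Rightarrow> real^'n \<Rightarrow> real^'n \<Rightarrow> real^'n" where
  "sigma R r b x = matrix_inv (real r *\<^sub>R R) *v x + b"

definition is_invariant_measure ::
    "real^'n^'n \<Rightarrow> (real^'n) set \<Rightarrow> nat \<Rightarrow> (real^'n) measure \<Rightarrow> bool" where
  "is_invariant_measure R B r M \<longleftrightarrow>
     prob_space M \<and> sets M = sets borel \<and>
     (\<forall>A\<in>sets borel. measure M A = (1 / real (card B)) * (\<Sum>b\<in>B. measure M (sigma R r b -` A)))"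

definition mu :: "real^'n^'n \<Rightarrow> (real^'n) set \<Rightarrow> nat \<Rightarrow> (real^'n) measure" where
  "mu R B r = (THE M. is_invariant_measure R B r M)"

definition spectrum_set :: "real^'n^'n \<Rightarrow> (real^'n) set \<Rightarrow> nat \<Rightarrow> (real^'n) set" where
  "spectrum_set R L r =
     {(\<Sum>k=0..n. matpow (real r *\<^sub>R transpose R) k *v l k) | n l. n \<ge> 1 \<and> (\<forall>k\<le>n. l k \<in> L)}"

(* L^2(M) is handled through representatives: elements are square-integrable functions,
   identified when they agree almost everywhere. *)
definition L2_space :: "'a measure \<Rightarrow> ('a \<Rightarrow> complex) set" where
  "L2_space M = {f \<in> borel_measurable M. integrable M (\<lambda>x. (cmod (f x))\<^sup>2)}"

definition L2_inner :: "'a measure \<Rightarrow> ('a \<Rightarrow> complex) \<Rightarrow> ('a \<Rightarrow> complex) \<Rightarrow> complex" where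
  "L2_inner M f g = (LINT x|M. f x * cnj (g x))"

definition L2_norm :: "'a measure \<Rightarrow> ('a \<Rightarrow> complex) \<Rightarrow> real" where
  "L2_norm M f = sqrt (LINT x|M. (cmod (f x))\<^sup>2)"

(* The family (e i), i in I, is orthonormal (so its members are pairwise distinct in L^2(M))
   and its finite linear combinations are dense in L^2(M). *)
definition orthonormal_basis_L2 :: "'a measure \<Rightarrow> 'i set \<Rightarrow> ('i \<Rightarrow> 'a \<Rightarrow> complex) \<Rightarrow> bool" where
  "orthonormal_basis_L2 M I e \<longleftrightarrow>
     (\<forall>i\<in>I. e i \<in> L2_space M) \<and>
     (\<forall>i\<in>I. \<forall>j\<in>I. L2_inner M (e i) (e j) = (if i = j then 1 else 0)) \<and>
     (\<forall>f\<in>L2_space M. \<forall>\<epsilon>>0. \<exists>F c. finite F \<and> F \<subseteq> I \<and>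
        L2_norm M (\<lambda>x. f x - (\<Sum>i\<in>F. c i * e i x)) < \<epsilon>)"

end

theory Submission
  imports Defs
begin

text \<open>
  Write \<open>S = r R\<^sup>*\<close>, \<open>T = S\<inverse>\<close>, let \<open>ft\<close> be the Fourier transform of the invariant measure and
  \<open>chi\<close> that of the uniform distribution on \<open>B\<close>. Invariance gives the two-scale equation
  \<open>ft t = chi t * ft (T t)\<close>. Integrality makes \<open>chi\<close> blind to all but the lowest digit of a
  frequency, and unitarity makes it vanish at differences of distinct digits; so two distinct
  frequencies meet a vanishing factor at the first digit in which they differ, and the
  exponentials are orthonormal (\<open>orthogonal\<close>).

  For completeness it suffices that every character \<open>expo t\<close> lies in the closed span, because
  trigonometric polynomials are dense in the square-integrable functions of a measure with
  bounded support (\<open>L2_closed_subspace_expo_total\<close>). By Bessel's identity this means that the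
  sums of \<open>|ft (t - \<lambda>)|\<^sup>2\<close> over the frequencies \<open>\<lambda>\<close> with \<open>n\<close> digits tend to one. By the
  two-scale equation these sums are the iterates of the transfer operator
  \<open>f \<mapsto> (t \<mapsto> \<Sum>l\<in>L. |chi (t - l)|\<^sup>2 f (T (t - l)))\<close>, whose weights sum to one by unitarity.
  They are probabilities of a Markov chain, and the claim becomes that the chain almost surely
  chooses the digit \<open>0\<close> from some time on. For large \<open>r\<close> the branches \<open>t \<mapsto> T (t - l)\<close> contract
  so strongly that the chain is caught in a ball around the origin on which \<open>|ft|\<^sup>2 \<ge> 1/2\<close>; there
  it has at every moment at least an even chance to choose \<open>0\<close> forever, so it eventually does
  (\<open>transfer_iter_tendsto_1\<close>). The radius of the ball is the same for all large \<open>r\<close>, because the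
  supports of the measures are uniformly bounded.

  The invariant measure itself is obtained as the law of a random series with independent digits
  (\<open>invariant_measure_exists\<close>), and Hutchinson's contraction argument gives its uniqueness
  (\<open>invariant_measure_unique\<close>).
\<close>

section \<open>Closed subspaces of square-integrable functions\<close>

lemma L2_spaceD:
  assumes "f \<in> L2_space M"
  shows "f \<in> borel_measurable M" "integrable M (\<lambda>x. (cmod (f x))\<^sup>2)"
  using assms by (auto simp: L2_space_def)

lemma cmod_add_sq_le: "(cmod (a + b))\<^sup>2 \<le> 2 * (cmod a)\<^sup>2 + 2 * (cmod b)\<^sup>2"
proof -
  have "(cmod (a + b))\<^sup>2 \<le> (cmod a + cmod b)\<^sup>2"
    by (intro power_mono norm_triangle_ineq) auto
  also have "\<dots> \<le> 2 * (cmod a)\<^sup>2 + 2 * (cmod b)\<^sup>2"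
    using sum_squares_bound[of "cmod a" "cmod b"] by (simp add: power2_sum)
  finally show ?thesis .
qed

lemma L2_space_add:
  assumes "f \<in> L2_space M" "g \<in> L2_space M"
  shows "(\<lambda>x. f x + g x) \<in> L2_space M"
proof -
  note [measurable] = L2_spaceD(1)[OF assms(1)] L2_spaceD(1)[OF assms(2)]
  have "integrable M (\<lambda>x. (cmod (f x + g x))\<^sup>2)"
    by (rule Bochner_Integration.integrable_bound
        [where f = "\<lambda>x. 2 * (cmod (f x))\<^sup>2 + 2 * (cmod (g x))\<^sup>2"])
       (use L2_spaceD(2)[OF assms(1)] L2_spaceD(2)[OF assms(2)] cmod_add_sq_le in \<open>auto intro!: AE_I2\<close>)
  then show ?thesis by (simp add: L2_space_def)
qed

lemma L2_space_cmult:
  assumes "f \<in> L2_space M"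
  shows "(\<lambda>x. c * f x) \<in> L2_space M"
  using assms by (auto simp: L2_space_def norm_mult power_mult_distrib)

lemma L2_space_diff:
  assumes "f \<in> L2_space M" "g \<in> L2_space M"
  shows "(\<lambda>x. f x - g x) \<in> L2_space M"
  using L2_space_add[OF assms(1) L2_space_cmult[OF assms(2), of "-1"]] by simp

lemma L2_space_sum:
  assumes "\<And>i. i \<in> F \<Longrightarrow> f i \<in> L2_space M"
  shows "(\<lambda>x. \<Sum>i\<in>F. f i x) \<in> L2_space M"
  using assms
proof (induction F rule: infinite_finite_induct)
  case (insert i F)
  then show ?case using L2_space_add[of "f i" M] by simp
qed (auto simp: L2_space_def)

lemma L2_norm_less_iff:
  assumes "0 < \<epsilon>"
  shows "L2_norm M f < \<epsilon> \<longleftrightarrow> (LINT x|M. (cmod (f x))\<^sup>2) < \<epsilon>\<^sup>2"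
  unfolding L2_norm_def using assms real_sqrt_less_iff[of _ "\<epsilon>\<^sup>2"] by simp

lemma L2_norm_add_sq_le:
  assumes "f \<in> L2_space M" "g \<in> L2_space M"
  shows "(LINT x|M. (cmod (f x + g x))\<^sup>2)
    \<le> 2 * (LINT x|M. (cmod (f x))\<^sup>2) + 2 * (LINT x|M. (cmod (g x))\<^sup>2)"
proof -
  have "(LINT x|M. (cmod (f x + g x))\<^sup>2) \<le> (LINT x|M. 2 * (cmod (f x))\<^sup>2 + 2 * (cmod (g x))\<^sup>2)"
    by (rule integral_mono)
       (use assms[THEN L2_spaceD(2)] L2_spaceD(2)[OF L2_space_add[OF assms]] in
         \<open>auto intro!: Bochner_Integration.integrable_add cmod_add_sq_le\<close>)
  also have "\<dots> = 2 * (LINT x|M. (cmod (f x))\<^sup>2) + 2 * (LINT x|M. (cmod (g x))\<^sup>2)"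
    using assms L2_spaceD(2) by (subst Bochner_Integration.integral_add) auto
  finally show ?thesis .
qed

text \<open>With the parallelogram bound in place of Minkowski's inequality a factor is lost, which
  approximation arguments do not notice.\<close>
lemma L2_norm_add_less:
  assumes "f \<in> L2_space M" "g \<in> L2_space M" "0 < \<epsilon>"
    and "L2_norm M f < \<epsilon> / 2" "L2_norm M g < \<epsilon> / 2"
  shows "L2_norm M (\<lambda>x. f x + g x) < \<epsilon>"
proof -
  have "(LINT x|M. (cmod (f x))\<^sup>2) < (\<epsilon> / 2)\<^sup>2" "(LINT x|M. (cmod (g x))\<^sup>2) < (\<epsilon> / 2)\<^sup>2"
    using assms L2_norm_less_iff[of "\<epsilon> / 2" M] by auto
  then have "(LINT x|M. (cmod (f x + g x))\<^sup>2) < \<epsilon>\<^sup>2"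
    using L2_norm_add_sq_le[OF assms(1,2)] by (simp add: power_divide)
  then show ?thesis using L2_norm_less_iff[OF \<open>0 < \<epsilon>\<close>, of M "\<lambda>x. f x + g x"] by simp
qed

lemma L2_norm_cmult: "L2_norm M (\<lambda>x. c * f x) = cmod c * L2_norm M f"
  unfolding L2_norm_def by (simp add: norm_mult power_mult_distrib real_sqrt_mult)

text \<open>Elements are functions rather than classes, so a closed subspace contains with a function every
  square-integrable function that agrees with it almost everywhere.\<close>
definition L2_closed_subspace :: "'a measure \<Rightarrow> ('a \<Rightarrow> complex) set \<Rightarrow> bool" where
  "L2_closed_subspace M V \<longleftrightarrow>
     V \<subseteq> L2_space M \<and> (\<lambda>_. 0) \<in> V \<and>
     (\<forall>f\<in>V. \<forall>g\<in>V. (\<lambda>x. f x + g x) \<in> V) \<and>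
     (\<forall>f\<in>V. \<forall>c. (\<lambda>x. c * f x) \<in> V) \<and>
     (\<forall>f\<in>L2_space M. (\<forall>\<epsilon>>0. \<exists>g\<in>V. L2_norm M (\<lambda>x. f x - g x) < \<epsilon>) \<longrightarrow> f \<in> V)"

lemma L2_closed_subspaceD:
  assumes "L2_closed_subspace M V"
  shows "V \<subseteq> L2_space M" "(\<lambda>_. 0) \<in> V"
    "f \<in> V \<Longrightarrow> g \<in> V \<Longrightarrow> (\<lambda>x. f x + g x) \<in> V"
    "f \<in> V \<Longrightarrow> (\<lambda>x. c * f x) \<in> V"
    "f \<in> L2_space M \<Longrightarrow> (\<And>\<epsilon>. 0 < \<epsilon> \<Longrightarrow> \<exists>g\<in>V. L2_norm M (\<lambda>x. f x - g x) < \<epsilon>) \<Longrightarrow> f \<in> V"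
  using assms unfolding L2_closed_subspace_def by auto

lemma L2_closed_subspace_sum:
  assumes "L2_closed_subspace M V" "\<And>i. i \<in> F \<Longrightarrow> f i \<in> V"
  shows "(\<lambda>x. \<Sum>i\<in>F. f i x) \<in> V"
  using assms(2)
proof (induction F rule: infinite_finite_induct)
  case (insert i F)
  then show ?case using L2_closed_subspaceD(3)[OF assms(1), of "f i"] by simp
qed (use L2_closed_subspaceD(2)[OF assms(1)] in auto)

lemma L2_closed_subspace_diff:
  assumes "L2_closed_subspace M V" "f \<in> V" "g \<in> V"
  shows "(\<lambda>x. f x - g x) \<in> V"
  using L2_closed_subspaceD(3)[OF assms(1,2) L2_closed_subspaceD(4)[OF assms(1,3), of "-1"]] by simp

text \<open>The density clause of \<open>orthonormal_basis_L2\<close>, read as a set of functions.\<close>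
definition L2_span_closure :: "'a measure \<Rightarrow> 'i set \<Rightarrow> ('i \<Rightarrow> 'a \<Rightarrow> complex) \<Rightarrow> ('a \<Rightarrow> complex) set" where
  "L2_span_closure M I e = {f \<in> L2_space M. \<forall>\<epsilon>>0. \<exists>F c. finite F \<and> F \<subseteq> I \<and>
        L2_norm M (\<lambda>x. f x - (\<Sum>i\<in>F. c i * e i x)) < \<epsilon>}"

lemma L2_span_closureD:
  assumes "f \<in> L2_span_closure M I e"
  shows "f \<in> L2_space M"
    "0 < \<epsilon> \<Longrightarrow> \<exists>F c. finite F \<and> F \<subseteq> I \<and> L2_norm M (\<lambda>x. f x - (\<Sum>i\<in>F. c i * e i x)) < \<epsilon>"
  using assms unfolding L2_span_closure_def by auto

lemma L2_span_closure_add: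
  assumes e: "\<And>i. i \<in> I \<Longrightarrow> e i \<in> L2_space M"
    and f: "f \<in> L2_span_closure M I e" and g: "g \<in> L2_span_closure M I e"
  shows "(\<lambda>x. f x + g x) \<in> L2_span_closure M I e"
proof -
  have comb: "(\<lambda>x. \<Sum>i\<in>F. c i * e i x) \<in> L2_space M" if "F \<subseteq> I" for F c
    using that e by (intro L2_space_sum L2_space_cmult) auto
  note L = L2_span_closureD(1)[OF f] L2_span_closureD(1)[OF g]
  have "\<exists>F c. finite F \<and> F \<subseteq> I \<and> L2_norm M (\<lambda>x. f x + g x - (\<Sum>i\<in>F. c i * e i x)) < \<epsilon>"
    if \<epsilon>: "\<epsilon> > 0" for \<epsilon>
  proof -
    have "\<epsilon> / 2 > 0" using \<epsilon> by simp
    obtain F c where F: "finite F" "F \<subseteq> I"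
        "L2_norm M (\<lambda>x. f x - (\<Sum>i\<in>F. c i * e i x)) < \<epsilon> / 2"
      using L2_span_closureD(2)[OF f \<open>\<epsilon> / 2 > 0\<close>] by auto
    obtain G d where G: "finite G" "G \<subseteq> I"
        "L2_norm M (\<lambda>x. g x - (\<Sum>i\<in>G. d i * e i x)) < \<epsilon> / 2"
      using L2_span_closureD(2)[OF g \<open>\<epsilon> / 2 > 0\<close>] by auto
    define h where "h i = (if i \<in> F then c i else 0) + (if i \<in> G then d i else 0)" for i
    have "(\<Sum>i\<in>F \<union> G. h i * e i x) = (\<Sum>i\<in>F. c i * e i x) + (\<Sum>i\<in>G. d i * e i x)" for x
    proof -
      have "(\<Sum>i\<in>F \<union> G. h i * e i x)
        = (\<Sum>i\<in>F \<union> G. (if i \<in> F then c i * e i x else 0))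
          + (\<Sum>i\<in>F \<union> G. (if i \<in> G then d i * e i x else 0))"
        unfolding h_def sum.distrib[symmetric] by (intro sum.cong) (auto simp: algebra_simps)
      also have "\<dots> = (\<Sum>i\<in>F. c i * e i x) + (\<Sum>i\<in>G. d i * e i x)"
        using F(1) G(1) by (simp add: sum.inter_restrict[symmetric] Int_absorb1)
      finally show ?thesis .
    qed
    then have eq: "(\<lambda>x. f x + g x - (\<Sum>i\<in>F \<union> G. h i * e i x))
      = (\<lambda>x. (f x - (\<Sum>i\<in>F. c i * e i x)) + (g x - (\<Sum>i\<in>G. d i * e i x)))"
      by (auto simp: algebra_simps)
    have "L2_norm M (\<lambda>x. f x + g x - (\<Sum>i\<in>F \<union> G. h i * e i x)) < \<epsilon>"
      unfolding eq
      by (rule L2_norm_add_less) (use F G \<epsilon> L comb in \<open>auto intro!: L2_space_diff\<close>)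
    then show ?thesis using F G by (intro exI[of _ "F \<union> G"] exI[of _ h]) auto
  qed
  then show ?thesis using L by (auto simp: L2_span_closure_def intro: L2_space_add)
qed

lemma L2_span_closure_cmult:
  assumes f: "f \<in> L2_span_closure M I e"
  shows "(\<lambda>x. k * f x) \<in> L2_span_closure M I e"
proof -
  have "\<exists>F c. finite F \<and> F \<subseteq> I \<and> L2_norm M (\<lambda>x. k * f x - (\<Sum>i\<in>F. c i * e i x)) < \<epsilon>"
    if \<epsilon>: "\<epsilon> > 0" for \<epsilon>
  proof -
    have pos: "\<epsilon> / (cmod k + 1) > 0" using \<epsilon> by (auto simp: add_nonneg_pos)
    obtain F c where F: "finite F" "F \<subseteq> I"
        "L2_norm M (\<lambda>x. f x - (\<Sum>i\<in>F. c i * e i x)) < \<epsilon> / (cmod k + 1)"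
      using L2_span_closureD(2)[OF f pos] by auto
    have eq: "(\<lambda>x. k * f x - (\<Sum>i\<in>F. (k * c i) * e i x)) = (\<lambda>x. k * (f x - (\<Sum>i\<in>F. c i * e i x)))"
      by (auto simp: algebra_simps sum_distrib_left)
    have "cmod k * L2_norm M (\<lambda>x. f x - (\<Sum>i\<in>F. c i * e i x)) \<le> cmod k * (\<epsilon> / (cmod k + 1))"
      using F(3) by (intro mult_left_mono) auto
    also have "\<dots> < \<epsilon>"
    proof -
      have "0 < cmod k + 1" by (simp add: add_nonneg_pos)
      then show ?thesis using \<epsilon> by (simp add: pos_divide_less_eq mult.commute)
    qed
    finally have "L2_norm M (\<lambda>x. k * f x - (\<Sum>i\<in>F. (k * c i) * e i x)) < \<epsilon>"
      unfolding eq L2_norm_cmult .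
    then show ?thesis
      using F(1,2) by (intro exI[of _ F] exI[of _ "\<lambda>i. k * c i"]) simp
  qed
  then show ?thesis
    using L2_span_closureD(1)[OF f] by (auto simp: L2_span_closure_def intro: L2_space_cmult)
qed

lemma L2_closed_subspace_span_closure:
  assumes e: "\<And>i. i \<in> I \<Longrightarrow> e i \<in> L2_space M"
  shows "L2_closed_subspace M (L2_span_closure M I e)"
proof -
  have comb: "(\<lambda>x. \<Sum>i\<in>F. c i * e i x) \<in> L2_space M" if "F \<subseteq> I" for F c
    using that e by (intro L2_space_sum L2_space_cmult) auto
  have zero: "(\<lambda>_. 0) \<in> L2_span_closure M I e"
    unfolding L2_span_closure_def
    by (auto simp: L2_space_def L2_norm_def intro!: exI[of _ "{}"])
  have closed: "f \<in> L2_span_closure M I e"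
    if f: "f \<in> L2_space M" "\<forall>\<epsilon>>0. \<exists>g\<in>L2_span_closure M I e. L2_norm M (\<lambda>x. f x - g x) < \<epsilon>" for f
  proof -
    have "\<exists>F c. finite F \<and> F \<subseteq> I \<and> L2_norm M (\<lambda>x. f x - (\<Sum>i\<in>F. c i * e i x)) < \<epsilon>"
      if \<epsilon>: "\<epsilon> > 0" for \<epsilon>
    proof -
      have "\<epsilon> / 2 > 0" using \<epsilon> by simp
      then obtain g where g: "g \<in> L2_span_closure M I e" "L2_norm M (\<lambda>x. f x - g x) < \<epsilon> / 2"
        using f(2) by blast
      obtain F c where F: "finite F" "F \<subseteq> I"
          "L2_norm M (\<lambda>x. g x - (\<Sum>i\<in>F. c i * e i x)) < \<epsilon> / 2"
        using L2_span_closureD(2)[OF g(1) \<open>\<epsilon> / 2 > 0\<close>] by auto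
      have eq: "(\<lambda>x. f x - (\<Sum>i\<in>F. c i * e i x))
          = (\<lambda>x. (f x - g x) + (g x - (\<Sum>i\<in>F. c i * e i x)))" by auto
      have "L2_norm M (\<lambda>x. f x - (\<Sum>i\<in>F. c i * e i x)) < \<epsilon>"
        unfolding eq
        by (rule L2_norm_add_less)
           (use F \<epsilon> f(1) L2_span_closureD(1)[OF g(1)] g(2) comb in \<open>auto intro!: L2_space_diff\<close>)
      then show ?thesis using F by blast
    qed
    then show ?thesis using f(1) by (auto simp: L2_span_closure_def)
  qed
  show ?thesis
    unfolding L2_closed_subspace_def
  proof (intro conjI subsetI ballI allI impI)
    show "f \<in> L2_space M" if "f \<in> L2_span_closure M I e" for f
      using that by (rule L2_span_closureD(1))
  qed (simp_all add: zero L2_span_closure_add[OF e] L2_span_closure_cmult closed)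
qed

text \<open>The form in which closedness is used: dominated almost everywhere convergence is convergence in
  mean square.\<close>
lemma L2_closed_subspace_dominated_limit:
  assumes V: "L2_closed_subspace M V" and s: "\<And>n. s n \<in> V" and f: "f \<in> L2_space M"
    and w: "integrable M w"
    and lim: "AE x in M. (\<lambda>n. s n x) \<longlonglongrightarrow> f x"
    and dom: "\<And>n. AE x in M. (cmod (f x - s n x))\<^sup>2 \<le> w x"
  shows "f \<in> V"
proof (rule L2_closed_subspaceD(5)[OF V f])
  fix \<epsilon> :: real assume \<epsilon>: "\<epsilon> > 0"
  have sL: "s n \<in> L2_space M" for n using s L2_closed_subspaceD(1)[OF V] by auto
  note [measurable] = L2_spaceD(1)[OF f] L2_spaceD(1)[OF sL]
  have [measurable]: "w \<in> borel_measurable M" using w by auto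
  have "(\<lambda>n. LINT x|M. (cmod (f x - s n x))\<^sup>2) \<longlonglongrightarrow> (LINT x|M. 0)"
  proof (rule integral_dominated_convergence[where w = w])
    show "AE x in M. (\<lambda>n. (cmod (f x - s n x))\<^sup>2) \<longlonglongrightarrow> 0"
      using lim
    proof eventually_elim
      case (elim x)
      have "(\<lambda>n. (cmod (f x - s n x))\<^sup>2) \<longlonglongrightarrow> (cmod (f x - f x))\<^sup>2"
        by (intro tendsto_intros elim)
      then show ?case by simp
    qed
  qed (use dom w in auto)
  then have "(\<lambda>n. LINT x|M. (cmod (f x - s n x))\<^sup>2) \<longlonglongrightarrow> 0" by simp
  then have "eventually (\<lambda>n. (LINT x|M. (cmod (f x - s n x))\<^sup>2) < \<epsilon>\<^sup>2) sequentially"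
    using \<epsilon> by (intro order_tendstoD(2)) auto
  then obtain n where "(LINT x|M. (cmod (f x - s n x))\<^sup>2) < \<epsilon>\<^sup>2"
    by (meson eventually_happens sequentially_bot)
  then show "\<exists>g\<in>V. L2_norm M (\<lambda>x. f x - g x) < \<epsilon>"
    using s \<epsilon> by (auto simp: L2_norm_less_iff)
qed

lemma L2_space_bounded:
  assumes "finite_measure M" "f \<in> borel_measurable M" "\<And>x. cmod (f x) \<le> C"
  shows "f \<in> L2_space M"
proof -
  interpret finite_measure M by fact
  have "(cmod (f x))\<^sup>2 \<le> C\<^sup>2" for x by (intro power_mono assms) auto
  then have "integrable M (\<lambda>x. (cmod (f x))\<^sup>2)"
    using assms(2) by (intro integrable_const_bound[where B = "C\<^sup>2"]) (auto intro!: AE_I2)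
  then show ?thesis using assms(2) by (simp add: L2_space_def)
qed

section \<open>Exponentials and cut-offs\<close>

lemma expo_add: "expo (s + t) x = expo s x * expo t x"
  by (simp add: expo_def inner_add_left algebra_simps exp_add)

lemma expo_add_right: "expo t (x + y) = expo t x * expo t y"
  by (simp add: expo_def inner_add_right algebra_simps exp_add)

lemma cnj_expo: "cnj (expo t x) = expo (- t) x"
  by (simp add: expo_def exp_cnj)

lemma expo_zero [simp]: "expo 0 x = 1"
  by (simp add: expo_def)

lemma norm_expo [simp]: "cmod (expo t x) = 1"
  by (simp add: expo_def)

lemma expo_diff: "expo (s - t) x = expo s x * cnj (expo t x)"
  using expo_add[of s "- t" x] by (simp add: cnj_expo)

lemma continuous_on_expo: "continuous_on A (expo t)"
  unfolding expo_def by (intro continuous_intros)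

lemma borel_measurable_expo [measurable]: "expo t \<in> borel_measurable borel"
  by (intro borel_measurable_continuous_onI continuous_on_expo)

definition cutoff :: "'a::metric_space set \<Rightarrow> nat \<Rightarrow> 'a \<Rightarrow> real" where
  "cutoff F n x = max 0 (1 - real n * infdist x F)"

lemma cutoff_bounds: "0 \<le> cutoff F n x" "cutoff F n x \<le> 1"
  by (auto simp: cutoff_def infdist_nonneg)

lemma cutoff_lipschitz: "\<bar>cutoff F n x - cutoff F n y\<bar> \<le> real n * dist x y"
proof -
  have "\<bar>infdist x F - infdist y F\<bar> \<le> dist x y"
    using infdist_triangle[of x F y] infdist_triangle[of y F x] by (auto simp: dist_commute)
  then have "\<bar>real n * infdist x F - real n * infdist y F\<bar> \<le> real n * dist x y"
    by (metis abs_mult abs_of_nat mult_left_mono of_nat_0_le_iff right_diff_distrib)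
  then show ?thesis unfolding cutoff_def by (auto simp: max_def abs_if split: if_splits)
qed

lemma continuous_on_cutoff: "continuous_on A (cutoff F n)"
  unfolding cutoff_def by (intro continuous_intros)

lemma borel_measurable_cutoff [measurable]: "cutoff F n \<in> borel_measurable borel"
  by (intro borel_measurable_continuous_onI continuous_on_cutoff)

lemma cutoff_tendsto_indicator:
  assumes "closed F" "F \<noteq> {}"
  shows "(\<lambda>n. cutoff F n x) \<longlonglongrightarrow> indicator F x"
proof (cases "x \<in> F")
  case True
  then show ?thesis by (simp add: cutoff_def)
next
  case False
  then have d: "infdist x F > 0"
    using assms by (meson infdist_pos_not_in_closed)
  obtain n0 :: nat where "1 / infdist x F < real n0" using reals_Archimedean2 by blast
  then have "cutoff F n x = 0" if "n \<ge> n0" for n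
  proof -
    have "1 / infdist x F \<le> real n" using \<open>1 / infdist x F < real n0\<close> that by linarith
    then show ?thesis using d by (simp add: cutoff_def field_simps)
  qed
  then have "eventually (\<lambda>n. cutoff F n x = 0) sequentially"
    by (auto simp: eventually_sequentially)
  then show ?thesis using False by (simp add: tendsto_eventually)
qed

lemma sets_borel_eq_closed: "sets borel = sigma_sets UNIV (Collect closed :: 'a::topological_space set set)"
  by (simp add: borel_eq_closed sets_measure_of)

text \<open>Bounded Lipschitz functions determine a measure: their limits include the indicators of
  closed sets, which form a generating \<open>\<pi>\<close>-system.\<close>
lemma measure_eqI_lipschitz:
  fixes M N :: "'a::metric_space measure"
  assumes "prob_space M" "prob_space N" and sM: "sets M = sets borel" and sN: "sets N = sets borel"
    and eq: "\<And>f :: 'a \<Rightarrow> real. \<And>C. 0 \<le> C \<Longrightarrow> (\<And>x. 0 \<le> f x \<and> f x \<le> 1) \<Longrightarrow> (\<And>x y. \<bar>f x - f y\<bar> \<le> C * dist x y)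
       \<Longrightarrow> f \<in> borel_measurable borel \<Longrightarrow> (LINT x|M. f x) = (LINT x|N. f x)"
  shows "M = N"
proof -
  interpret M: prob_space M by fact
  interpret N: prob_space N by fact
  show ?thesis
  proof (rule measure_eqI_generator_eq[where E = "Collect closed" and \<Omega> = UNIV and A = "\<lambda>_. UNIV"])
    fix F :: "'a set" assume "F \<in> Collect closed"
    then have F: "closed F" by simp
    show "emeasure M F = emeasure N F"
    proof (cases "F = {}")
      case False
      have lim: "(\<lambda>n. LINT x|K. cutoff F n x) \<longlonglongrightarrow> measure K F"
        if K: "prob_space K" and sK: "sets K = sets borel" for K :: "'a measure"
      proof -
        interpret K: prob_space K by fact
        note [measurable_cong] = sK
        have [measurable]: "F \<in> sets K" using F sK by simp
        have "(\<lambda>n. LINT x|K. cutoff F n x) \<longlonglongrightarrow> (LINT x|K. indicator F x)"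
          by (rule integral_dominated_convergence[where w = "\<lambda>_. 1"])
             (simp_all add: cutoff_bounds abs_of_nonneg cutoff_tendsto_indicator[OF F False])
        then show ?thesis using sets.sets_into_space[of F K] by (simp add: Int_absorb2)
      qed
      have "(LINT x|M. cutoff F n x) = (LINT x|N. cutoff F n x)" for n
        by (rule eq[where C = "real n"]) (use cutoff_bounds cutoff_lipschitz in auto)
      then have "measure M F = measure N F"
        using LIMSEQ_unique[OF lim[OF assms(1) sM]] lim[OF assms(2) sN] by simp
      then show ?thesis by (simp add: M.emeasure_eq_measure N.emeasure_eq_measure)
    qed simp
  qed (auto simp: Int_stable_def sM sN sets_borel_eq_closed)
qed

lemma expo_separates:
  assumes "x \<noteq> y"
  shows "\<exists>t. expo t x \<noteq> expo t y"
proof -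
  \<comment> \<open>The frequency is tuned so that the two values are opposite points of the circle.\<close>
  define t where "t = (1 / (2 * ((x - y) \<bullet> (x - y)))) *\<^sub>R (x - y)"
  have "t \<bullet> (x - y) = 1 / 2"
    using assms by (simp add: t_def)
  then have "2 * pi * (t \<bullet> (x - y)) = pi" by simp
  then have "expo t (x - y) = exp (\<i> * complex_of_real pi)"
    unfolding expo_def by presburger
  then have "expo t (x - y) = -1"
    by (metis exp_pi_i mult.commute)
  moreover have "expo t x = expo t (x - y) * expo t y"
    using expo_add_right[of t "x - y" y] by simp
  ultimately have "expo t x = - expo t y" by simp
  moreover have "expo t y \<noteq> 0" using norm_expo[of t y] by force
  ultimately have "expo t x \<noteq> expo t y" by simp
  then show ?thesis ..
qed

section \<open>Density of trigonometric polynomials\<close>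

inductive_set trig_polys :: "(real^'n \<Rightarrow> complex) set" where
  monomial: "(\<lambda>x. c * expo t x) \<in> trig_polys"
| add: "f \<in> trig_polys \<Longrightarrow> g \<in> trig_polys \<Longrightarrow> (\<lambda>x. f x + g x) \<in> trig_polys"

lemma trig_polys_mult:
  assumes "f \<in> trig_polys" "g \<in> trig_polys"
  shows "(\<lambda>x. f x * g x) \<in> trig_polys"
  using assms(1)
proof induction
  case (monomial c t)
  show ?case
    using assms(2)
  proof induction
    case (monomial d s)
    then show ?case
      using trig_polys.monomial[of "c * d" "t + s"] by (simp add: expo_add algebra_simps)
  next
    case (add f g)
    then show ?case
      using trig_polys.add[OF add.IH] by (simp add: algebra_simps)
  qed
next
  case (add f g)
  then show ?case
    using trig_polys.add[OF add.IH] by (simp add: algebra_simps)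
qed

lemma continuous_on_trig_polys: "f \<in> trig_polys \<Longrightarrow> continuous_on A f"
  by (induction rule: trig_polys.induct) (auto intro!: continuous_intros continuous_on_expo)

lemma trig_polys_subset:
  fixes V :: "(real^'n \<Rightarrow> complex) set"
  assumes "L2_closed_subspace M V" "\<And>t. expo t \<in> V"
  shows "trig_polys \<subseteq> V"
proof
  fix f :: "real^'n \<Rightarrow> complex" assume "f \<in> trig_polys"
  then show "f \<in> V"
    by induction (use L2_closed_subspaceD(3,4)[OF assms(1)] assms(2) in auto)
qed

text \<open>The real-valued trigonometric polynomials form an algebra that separates points, because
  the real and imaginary parts of a character are among them.\<close>
lemma trig_polys_uniform_approx:
  fixes f :: "real^'n \<Rightarrow> real"
  assumes "compact S" "continuous_on S f" "0 < \<epsilon>"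
  shows "\<exists>g. (\<lambda>x. complex_of_real (g x)) \<in> trig_polys \<and> (\<forall>x\<in>S. \<bar>f x - g x\<bar> < \<epsilon>)"
proof (rule Stone_Weierstrass_HOL[where P = "\<lambda>g. (\<lambda>x. complex_of_real (g x)) \<in> trig_polys"])
  show "(\<lambda>x. complex_of_real c) \<in> trig_polys" for c
    using trig_polys.monomial[of "complex_of_real c" 0] by simp
  show "continuous_on S g" if "(\<lambda>x. complex_of_real (g x)) \<in> trig_polys" for g
    using continuous_on_Re[OF continuous_on_trig_polys[OF that]] by simp
  show "(\<lambda>x. complex_of_real (g x + h x)) \<in> trig_polys"
    if "(\<lambda>x. complex_of_real (g x)) \<in> trig_polys \<and> (\<lambda>x. complex_of_real (h x)) \<in> trig_polys" for g h
    using trig_polys.add that by fastforce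
  show "(\<lambda>x. complex_of_real (g x * h x)) \<in> trig_polys"
    if "(\<lambda>x. complex_of_real (g x)) \<in> trig_polys \<and> (\<lambda>x. complex_of_real (h x)) \<in> trig_polys" for g h
    using trig_polys_mult that by fastforce
  show "\<exists>g. (\<lambda>x. complex_of_real (g x)) \<in> trig_polys \<and> g x \<noteq> g y"
    if xy: "x \<in> S \<and> y \<in> S \<and> x \<noteq> y" for x y
  proof -
    obtain t where t: "expo t x \<noteq> expo t y" using expo_separates[of x y] xy by blast
    have "(\<lambda>x. 1 / 2 * expo t x + 1 / 2 * expo (- t) x) \<in> trig_polys"
      by (intro trig_polys.intros)
    moreover have "(\<lambda>x. 1 / 2 * expo t x + 1 / 2 * expo (- t) x)
        = (\<lambda>x. complex_of_real (Re (expo t x)))"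
      by (auto simp: cnj_expo[symmetric] complex_eq_iff)
    moreover have "(\<lambda>x. 1 / (2 * \<i>) * expo t x + - 1 / (2 * \<i>) * expo (- t) x) \<in> trig_polys"
      by (intro trig_polys.intros)
    moreover have "(\<lambda>x. 1 / (2 * \<i>) * expo t x + - 1 / (2 * \<i>) * expo (- t) x)
        = (\<lambda>x. complex_of_real (Im (expo t x)))"
      by (auto simp: cnj_expo[symmetric] complex_eq_iff)
    ultimately show ?thesis using t by (auto simp: complex_eq_iff)
  qed
qed (use assms in auto)

text \<open>In stages: uniform approximation on the support gives continuous functions, cut-offs give
  indicators of closed sets, a Dynkin argument gives indicators of Borel sets, and simple
  functions approximate the rest.\<close>
lemma L2_closed_subspace_expo_total:
  fixes M :: "(real^'n) measure"
  assumes fin: "finite_measure M" and sM: "sets M = sets borel"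
    and bdd: "AE x in M. norm x \<le> K"
    and V: "L2_closed_subspace M V" and expo: "\<And>t. expo t \<in> V"
  shows "L2_space M \<subseteq> V"
proof -
  interpret finite_measure M by fact
  note [measurable_cong] = sM
  have spM: "space M = UNIV" using sets_eq_imp_space_eq[OF sM] by simp
  have cont: "(\<lambda>x. complex_of_real (f x)) \<in> V"
    if f: "continuous_on UNIV f" and f01: "\<And>x. \<bar>f x\<bar> \<le> 1" for f
  proof -
    have [measurable]: "f \<in> borel_measurable borel"
      by (intro borel_measurable_continuous_onI f)
    have "\<exists>g. (\<lambda>x. complex_of_real (g x)) \<in> trig_polys
        \<and> (\<forall>x\<in>cball 0 K. \<bar>f x - g x\<bar> < 1 / real (Suc n))" for n
      by (rule trig_polys_uniform_approx) (use f continuous_on_subset in auto)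
    then obtain g where g: "\<And>n. (\<lambda>x. complex_of_real (g n x)) \<in> trig_polys"
        "\<And>n x. x \<in> cball 0 K \<Longrightarrow> \<bar>f x - g n x\<bar> < 1 / real (Suc n)"
      by metis
    show ?thesis
    proof (rule L2_closed_subspace_dominated_limit[OF V, where s = "\<lambda>n x. complex_of_real (g n x)"
          and w = "\<lambda>_. 1"])
      show "(\<lambda>x. complex_of_real (g n x)) \<in> V" for n
        using g(1) trig_polys_subset[OF V expo] by auto
      show "(\<lambda>x. complex_of_real (f x)) \<in> L2_space M"
        by (rule L2_space_bounded[OF fin, where C = 1]) (use f01 in auto)
      show "AE x in M. (\<lambda>n. complex_of_real (g n x)) \<longlonglongrightarrow> complex_of_real (f x)"
        using bdd
      proof eventually_elim
        case (elim x)
        have "(\<lambda>n. f x - g n x) \<longlonglongrightarrow> 0"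
        proof (rule Lim_null_comparison[OF _ LIMSEQ_inverse_real_of_nat])
          show "\<forall>\<^sub>F n in sequentially. norm (f x - g n x) \<le> inverse (real (Suc n))"
            using g(2)[of x] elim
            by (auto intro!: always_eventually less_imp_le simp: inverse_eq_divide)
        qed
        then have "(\<lambda>n. g n x) \<longlonglongrightarrow> f x"
          using Lim_transform2[of "\<lambda>_. f x" "f x" sequentially "\<lambda>n. g n x"] by simp
        then show ?case by (rule tendsto_of_real)
      qed
      show "AE x in M. (cmod (complex_of_real (f x) - complex_of_real (g n x)))\<^sup>2 \<le> 1" for n
        using bdd
      proof eventually_elim
        case (elim x)
        have "\<bar>f x - g n x\<bar> \<le> 1 / real (Suc n)" using g(2)[of x n] elim by simp
        also have "\<dots> \<le> 1" by simp
        finally have "\<bar>f x - g n x\<bar> \<le> 1" .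
        then show ?case
          by (simp add: of_real_diff[symmetric] abs_square_le_1 del: of_real_diff)
      qed
    qed simp
  qed
  have indicator_L2: "indicator A \<in> L2_space M" if [measurable]: "A \<in> sets borel" for A
    by (rule L2_space_bounded[OF fin, where C = 1]) (auto simp: indicator_def)
  have borel: "(indicator A :: _ \<Rightarrow> complex) \<in> V" if A: "A \<in> sets borel" for A
  proof -
    have "Int_stable (Collect closed :: (real^'n) set set)" by (auto simp: Int_stable_def)
    moreover have "Collect closed \<subseteq> Pow (UNIV :: (real^'n) set)" by simp
    moreover have "A \<in> sigma_sets UNIV (Collect closed)" using A by (simp add: sets_borel_eq_closed)
    ultimately show ?thesis
    proof (induction rule: sigma_sets_induct_disjoint)
      case (basic F)
      then have F: "closed F" by simp
      show ?case
      proof (cases "F = {}")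
        case True
        then show ?thesis using L2_closed_subspaceD(2)[OF V] by (simp add: indicator_def)
      next
        case False
        show ?thesis
        proof (rule L2_closed_subspace_dominated_limit[OF V, where w = "\<lambda>_. 1"
              and s = "\<lambda>n x. complex_of_real (cutoff F n x)"])
          show "(\<lambda>x. complex_of_real (cutoff F n x)) \<in> V" for n
            by (intro cont continuous_on_cutoff) (simp add: cutoff_bounds abs_of_nonneg)
          show "AE x in M. (\<lambda>n. complex_of_real (cutoff F n x)) \<longlonglongrightarrow> indicator F x"
          proof (rule AE_I2)
            fix x
            show "(\<lambda>n. complex_of_real (cutoff F n x)) \<longlonglongrightarrow> indicator F x"
              using tendsto_of_real[OF cutoff_tendsto_indicator[OF F False, of x], where 'a = complex]
              by (cases "x \<in> F") simp_all
          qed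
          show "AE x in M. (cmod (indicator F x - complex_of_real (cutoff F n x)))\<^sup>2 \<le> 1" for n
          proof (rule AE_I2)
            fix x
            have "\<bar>indicator F x - cutoff F n x\<bar> \<le> 1"
              using cutoff_bounds[of F n x] by (auto simp: indicator_def)
            moreover have "indicator F x - complex_of_real (cutoff F n x)
              = complex_of_real (indicator F x - cutoff F n x)" by (simp add: indicator_def)
            ultimately show "(cmod (indicator F x - complex_of_real (cutoff F n x)))\<^sup>2 \<le> 1"
              by (metis abs_square_le_1 norm_of_real power2_abs)
          qed
        qed (use indicator_L2 F in auto)
      qed
    next
      case empty
      then show ?case using L2_closed_subspaceD(2)[OF V] by (simp add: indicator_def)
    next
      case (compl A)
      have "expo 0 = (\<lambda>_ :: real^'n. 1)" by auto
      then have "(\<lambda>_. 1) \<in> V" using expo[of 0] by simp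
      then have "(\<lambda>x. 1 - indicator A x :: complex) \<in> V"
        by (rule L2_closed_subspace_diff[OF V _ compl.IH])
      moreover have "(\<lambda>x. 1 - indicator A x :: complex) = indicator (UNIV - A)"
        by (auto simp: indicator_def)
      ultimately show ?case by simp
    next
      case (union A)
      have [measurable]: "A i \<in> sets borel" for i
        using union.hyps(2) by (auto simp: sets_borel_eq_closed)
      have part: "(\<lambda>x. \<Sum>i<n. indicator (A i) x :: complex) \<in> V" for n
        by (rule L2_closed_subspace_sum[OF V]) (use union.IH in auto)
      have eq: "(\<Sum>i<n. indicator (A i) x) = (indicator (\<Union>i<n. A i) x :: complex)" for n x
      proof (induction n)
        case (Suc n)
        have "x \<notin> (\<Union>i<n. A i)" if "x \<in> A n"
        proof
          assume "x \<in> (\<Union>i<n. A i)"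
          then obtain i where "i < n" "x \<in> A i" by auto
          then show False using disjoint_family_onD[OF union.hyps(1), of i n] that by auto
        qed
        moreover have "(\<Union>i<Suc n. A i) = (\<Union>i<n. A i) \<union> A n"
          by (simp add: lessThan_Suc Un_commute)
        ultimately have "indicator (\<Union>i<Suc n. A i) x
            = (indicator (\<Union>i<n. A i) x + indicator (A n) x :: complex)"
          by (auto simp: indicator_def)
        then show ?case using Suc by simp
      qed simp
      show ?case
      proof (rule L2_closed_subspace_dominated_limit[OF V part, where w = "\<lambda>_. 1"])
        show "AE x in M. (\<lambda>n. \<Sum>i<n. indicator (A i) x) \<longlonglongrightarrow> (indicator (\<Union> (range A)) x :: complex)"
          unfolding eq by (rule AE_I2) (rule LIMSEQ_indicator_UN)
        show "AE x in M. (cmod (indicator (\<Union> (range A)) x - (\<Sum>i<n. indicator (A i) x)))\<^sup>2 \<le> 1" for n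
          unfolding eq by (rule AE_I2) (auto simp: indicator_def)
      qed (use indicator_L2 in auto)
    qed
  qed
  show ?thesis
  proof
    fix f assume f: "f \<in> L2_space M"
    note [measurable] = L2_spaceD(1)[OF f]
    obtain s where s: "\<And>i. simple_function M (s i)" "\<And>x. (\<lambda>i. s i x) \<longlonglongrightarrow> f x"
        "\<And>i x. cmod (s i x) \<le> 2 * cmod (f x)"
      using borel_measurable_implies_sequence_metric[OF L2_spaceD(1)[OF f], of 0] spM
      by auto
    have sV: "s i \<in> V" for i
    proof -
      have "(\<lambda>x. \<Sum>y\<in>s i ` space M. y * indicator (s i -` {y}) x) \<in> V"
      proof (rule L2_closed_subspace_sum[OF V])
        fix y
        have "s i -` {y} \<in> sets borel"
          using simple_functionD(2)[OF s(1)[of i], of "{y}"] spM sM by simp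
        then show "(\<lambda>x. y * indicator (s i -` {y}) x) \<in> V"
          by (intro L2_closed_subspaceD(4)[OF V] borel)
      qed
      moreover have "(\<Sum>y\<in>s i ` space M. y * indicator (s i -` {y}) x) = s i x" for x
      proof -
        have "(\<Sum>y\<in>s i ` space M. y * indicator (s i -` {y}) x)
          = (\<Sum>y\<in>s i ` space M. if y = s i x then y else 0)"
          by (intro sum.cong) (auto simp: indicator_def)
        then show ?thesis using simple_functionD(1)[OF s(1)[of i]] spM by (simp add: sum.delta)
      qed
      ultimately show ?thesis by simp
    qed
    show "f \<in> V"
    proof (rule L2_closed_subspace_dominated_limit[OF V _ f, where s = s and w = "\<lambda>x. 9 * (cmod (f x))\<^sup>2"])
      show "AE x in M. (cmod (f x - s n x))\<^sup>2 \<le> 9 * (cmod (f x))\<^sup>2" for n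
      proof (rule AE_I2)
        fix x
        have "cmod (f x - s n x) \<le> 3 * cmod (f x)"
          using norm_triangle_ineq4[of "f x" "s n x"] s(3)[of n x] by linarith
        then have "(cmod (f x - s n x))\<^sup>2 \<le> (3 * cmod (f x))\<^sup>2" by (intro power_mono) auto
        then show "(cmod (f x - s n x))\<^sup>2 \<le> 9 * (cmod (f x))\<^sup>2" by (simp add: power_mult_distrib)
      qed
    qed (use s sV L2_spaceD(2)[OF f] in auto)
  qed
qed

section \<open>The invariant measure\<close>

lemma continuous_on_sigma: "continuous_on A (sigma R r b)"
  unfolding sigma_def
  by (intro continuous_intros linear_continuous_on linear_linear[THEN iffD2] matrix_vector_mul_linear)

lemma borel_measurable_sigma [measurable]: "sigma R r b \<in> borel_measurable borel"
  by (intro borel_measurable_continuous_onI continuous_on_sigma)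

lemma invariant_measureD:
  assumes "is_invariant_measure R B r M"
  shows "prob_space M" "sets M = sets borel" "space M = UNIV"
    "A \<in> sets borel \<Longrightarrow>
      measure M A = (1 / real (card B)) * (\<Sum>b\<in>B. measure M (sigma R r b -` A))"
  using assms sets_eq_imp_space_eq[of M borel] unfolding is_invariant_measure_def by auto

text \<open>Invariance says that first choosing \<open>b\<close> uniformly and then moving a random point by
  \<open>sigma R r b\<close> reproduces the measure; this lets integrals be computed by conditioning on
  \<open>b\<close>.\<close>
lemma invariant_measure_integral_real:
  fixes f :: "real^'n \<Rightarrow> real"
  assumes M: "is_invariant_measure R B r M" and B: "finite B" "B \<noteq> {}"
    and f[measurable]: "f \<in> borel_measurable borel" and bdd: "\<And>x. \<bar>f x\<bar> \<le> C"
  shows "(LINT x|M. f x) = (\<Sum>b\<in>B. LINT x|M. f (sigma R r b x)) / real (card B)"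
proof -
  interpret prob_space M using M by (rule invariant_measureD(1))
  have sM[measurable_cong]: "sets M = sets borel" using M by (rule invariant_measureD(2))
  let ?U = "uniform_count_measure B"
  let ?K = "\<lambda>b. distr M borel (sigma R r b)"
  have U: "prob_space ?U" using B by (rule prob_space_uniform_count_measure)
  have K: "?K \<in> ?U \<rightarrow>\<^sub>M subprob_algebra borel"
    by (auto simp: measurable_def sets_uniform_count_measure space_uniform_count_measure
        space_subprob_algebra intro!: prob_space_imp_subprob_space prob_space_distr)
  have "M = bind ?U ?K"
  proof (rule measure_eqI)
    show "sets M = sets (bind ?U ?K)"
      using B by (subst sets_bind[of _ _ borel]) (auto simp: sM space_uniform_count_measure)
    fix A assume "A \<in> sets M"
    then have A[measurable]: "A \<in> sets borel" using sM by simp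
    have pre: "emeasure (?K b) A = ennreal (measure M (sigma R r b -` A))" for b
      using sets_eq_imp_space_eq[OF sM]
      by (subst emeasure_distr) (auto simp: emeasure_eq_measure)
    have "emeasure (bind ?U ?K) A = (\<integral>\<^sup>+b. emeasure (?K b) A \<partial>?U)"
      using B by (intro emeasure_bind[OF _ K A]) (simp add: space_uniform_count_measure)
    also have "\<dots> = (\<Sum>b\<in>B. ennreal (1 / real (card B)) * ennreal (measure M (sigma R r b -` A)))"
      using B by (simp add: pre uniform_count_measure_def nn_integral_point_measure_finite)
    also have "\<dots> = ennreal ((1 / real (card B)) * (\<Sum>b\<in>B. measure M (sigma R r b -` A)))"
      by (simp add: ennreal_mult[symmetric] sum_distrib_left)
    also have "\<dots> = emeasure M A"
      using invariant_measureD(4)[OF M A] by (simp add: emeasure_eq_measure)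
    finally show "emeasure M A = emeasure (bind ?U ?K) A" ..
  qed
  then have "(LINT x|M. f x) = (LINT x|bind ?U ?K. f x)" by simp
  also have "\<dots> = (LINT b|?U. LINT x|?K b. f x)"
  proof (rule integral_bind[OF f _ K, where B' = 1])
    show "finite_measure ?U" using U by (rule prob_space.finite_measure)
    show "AE b in ?U. emeasure (?K b) (space (?K b)) \<le> ennreal 1"
    proof (rule AE_I2)
      fix b
      have "prob_space (?K b)" by (rule prob_space_distr) simp
      from prob_space.emeasure_space_1[OF this]
      show "emeasure (?K b) (space (?K b)) \<le> ennreal 1" by simp
    qed
  qed (use bdd in auto)
  also have "\<dots> = (\<Sum>b\<in>B. LINT x|?K b. f x) / real (card B)"
    using B by (simp add: integral_uniform_count_measure)
  also have "\<dots> = (\<Sum>b\<in>B. LINT x|M. f (sigma R r b x)) / real (card B)"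
    by (simp add: integral_distr)
  finally show ?thesis .
qed

lemma (in finite_measure) integrable_bounded:
  fixes f :: "'a \<Rightarrow> 'b::{banach, second_countable_topology}"
  assumes "f \<in> borel_measurable M" "\<And>x. norm (f x) \<le> C"
  shows "integrable M f"
  using assms by (intro integrable_const_bound[where B = C]) auto

lemma invariant_measure_integral_complex:
  fixes f :: "real^'n \<Rightarrow> complex"
  assumes M: "is_invariant_measure R B r M" and B: "finite B" "B \<noteq> {}"
    and f[measurable]: "f \<in> borel_measurable borel" and bdd: "\<And>x. cmod (f x) \<le> C"
  shows "(LINT x|M. f x) = (\<Sum>b\<in>B. LINT x|M. f (sigma R r b x)) / of_nat (card B)"
proof -
  interpret prob_space M using M by (rule invariant_measureD(1))
  have sM[measurable_cong]: "sets M = sets borel" using M by (rule invariant_measureD(2))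
  have int: "integrable M f" "integrable M (\<lambda>x. f (sigma R r b x))" for b
    using bdd by (auto intro!: integrable_bounded)
  have parts: "\<bar>Re (f x)\<bar> \<le> C" "\<bar>Im (f x)\<bar> \<le> C" for x
    using abs_Re_le_cmod[of "f x"] abs_Im_le_cmod[of "f x"] bdd[of x] by linarith+
  have "Re (LINT x|M. f x) = Re ((\<Sum>b\<in>B. LINT x|M. f (sigma R r b x)) / of_nat (card B))"
    using invariant_measure_integral_real[OF M B, of "\<lambda>x. Re (f x)" C] parts int
    by (simp add: Re_divide_of_nat)
  moreover have "Im (LINT x|M. f x) = Im ((\<Sum>b\<in>B. LINT x|M. f (sigma R r b x)) / of_nat (card B))"
    using invariant_measure_integral_real[OF M B, of "\<lambda>x. Im (f x)" C] parts int
    by (simp add: Im_divide_of_nat)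
  ultimately show ?thesis by (rule complex_eqI)
qed

text \<open>The dual of the invariance equation: the average over the maps turns a test function into
  a flatter one, so iterating it makes every Lipschitz test function almost constant.\<close>
definition average_op :: "real^'n^'n \<Rightarrow> (real^'n) set \<Rightarrow> nat \<Rightarrow> (real^'n \<Rightarrow> real) \<Rightarrow> real^'n \<Rightarrow> real" where
  "average_op R B r f x = (\<Sum>b\<in>B. f (sigma R r b x)) / real (card B)"

lemma dist_sigma: "dist (sigma R r b x) (sigma R r b y) = norm (matrix_inv (real r *\<^sub>R R) *v (x - y))"
  by (simp add: sigma_def dist_norm matrix_vector_mult_diff_distrib)

lemma average_op_power:
  fixes f :: "real^'n \<Rightarrow> real"
  assumes B: "finite B" "B \<noteq> {}" and c: "0 \<le> c"
    and contr: "\<And>x. norm (matrix_inv (real r *\<^sub>R R) *v x) \<le> c * norm x"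
    and f: "f \<in> borel_measurable borel" "\<And>x. 0 \<le> f x \<and> f x \<le> 1"
    and C: "0 \<le> C" "\<And>x y. \<bar>f x - f y\<bar> \<le> C * dist x y"
  defines "U \<equiv> \<lambda>n. (average_op R B r ^^ n) f"
  shows "U n \<in> borel_measurable borel \<and> (\<forall>x. 0 \<le> U n x \<and> U n x \<le> 1) \<and>
    (\<forall>x y. \<bar>U n x - U n y\<bar> \<le> C * c ^ n * dist x y) \<and>
    (\<forall>M. is_invariant_measure R B r M \<longrightarrow> (LINT x|M. U n x) = (LINT x|M. f x))"
proof (induction n)
  case 0
  then show ?case using f C by (simp add: U_def)
next
  case (Suc n)
  have US: "U (Suc n) x = (\<Sum>b\<in>B. U n (sigma R r b x)) / real (card B)" for x
    by (simp add: U_def average_op_def)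
  have N: "0 < real (card B)" using B by (simp add: card_gt_0_iff)
  have meas[measurable]: "U n \<in> borel_measurable borel" using Suc by simp
  have "U (Suc n) \<in> borel_measurable borel"
    unfolding US[abs_def] by measurable
  moreover have "0 \<le> U (Suc n) x \<and> U (Suc n) x \<le> 1" for x
  proof -
    have "(\<Sum>b\<in>B. U n (sigma R r b x)) \<le> (\<Sum>b\<in>B. 1)" using Suc by (intro sum_mono) auto
    moreover have "0 \<le> (\<Sum>b\<in>B. U n (sigma R r b x))" using Suc by (intro sum_nonneg) auto
    ultimately show ?thesis using N by (simp add: US)
  qed
  moreover have "\<bar>U (Suc n) x - U (Suc n) y\<bar> \<le> C * c ^ Suc n * dist x y" for x y
  proof -
    have "\<bar>(\<Sum>b\<in>B. U n (sigma R r b x)) - (\<Sum>b\<in>B. U n (sigma R r b y))\<bar>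
      \<le> (\<Sum>b\<in>B. \<bar>U n (sigma R r b x) - U n (sigma R r b y)\<bar>)"
      by (simp add: sum_subtractf[symmetric] sum_abs)
    also have "\<dots> \<le> (\<Sum>b\<in>B. C * c ^ Suc n * dist x y)"
    proof (rule sum_mono)
      fix b
      have "\<bar>U n (sigma R r b x) - U n (sigma R r b y)\<bar>
        \<le> C * c ^ n * dist (sigma R r b x) (sigma R r b y)" using Suc by blast
      also have "\<dots> \<le> C * c ^ n * (c * dist x y)"
        using contr[of "x - y"] C(1) c
        by (intro mult_left_mono) (auto simp: dist_sigma dist_norm[of x y])
      finally show "\<bar>U n (sigma R r b x) - U n (sigma R r b y)\<bar> \<le> C * c ^ Suc n * dist x y"
        by (simp add: algebra_simps)
    qed
    finally have "\<bar>(\<Sum>b\<in>B. U n (sigma R r b x)) - (\<Sum>b\<in>B. U n (sigma R r b y))\<bar>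
      \<le> C * c ^ Suc n * dist x y * real (card B)" by (simp add: mult.commute)
    then show ?thesis
      using N by (simp add: US diff_divide_distrib[symmetric] pos_divide_le_eq)
  qed
  moreover have "(LINT x|M. U (Suc n) x) = (LINT x|M. f x)" if M: "is_invariant_measure R B r M" for M
  proof -
    interpret prob_space M using M by (rule invariant_measureD(1))
    have sM[measurable_cong]: "sets M = sets borel" using M by (rule invariant_measureD(2))
    have bdd: "\<bar>U n x\<bar> \<le> 1" for x using Suc by (simp add: abs_of_nonneg)
    have int: "integrable M (\<lambda>x. U n (sigma R r b x))" for b
      by (rule integrable_bounded[where C = 1]) (use bdd in auto)
    have "(LINT x|M. U (Suc n) x) = (\<Sum>b\<in>B. LINT x|M. U n (sigma R r b x)) / real (card B)"
      unfolding US using int by (simp add: Bochner_Integration.integral_sum)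
    also have "\<dots> = (LINT x|M. U n x)"
      using invariant_measure_integral_real[OF M B meas bdd] by simp
    also have "\<dots> = (LINT x|M. f x)" using Suc M by blast
    finally show ?thesis .
  qed
  ultimately show ?case by blast
qed

text \<open>Uniqueness in Hutchinson's manner: the integral of a Lipschitz test function is the limit
  of its iterated averages at the origin, a number in which the measure does not occur.\<close>
lemma invariant_measure_unique:
  fixes R :: "real^'n^'n"
  assumes B: "finite B" "B \<noteq> {}" and c: "0 \<le> c" "c < 1"
    and contr: "\<And>x. norm (matrix_inv (real r *\<^sub>R R) *v x) \<le> c * norm x"
    and M: "is_invariant_measure R B r M" and N: "is_invariant_measure R B r N"
  shows "M = N"
proof (rule measure_eqI_lipschitz)
  fix f :: "real^'n \<Rightarrow> real" and C :: real
  assume C0: "0 \<le> C" and f01: "\<And>x. 0 \<le> f x \<and> f x \<le> 1"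
    and lip: "\<And>x y. \<bar>f x - f y\<bar> \<le> C * dist x y" and [measurable]: "f \<in> borel_measurable borel"
  define U where "U n = (average_op R B r ^^ n) f" for n
  note U = average_op_power[OF B c(1) contr \<open>f \<in> borel_measurable borel\<close> f01 C0 lip, folded U_def]
  have lim: "(\<lambda>n. U n 0) \<longlonglongrightarrow> (LINT x|K. f x)" if K: "is_invariant_measure R B r K" for K
  proof -
    interpret prob_space K using K by (rule invariant_measureD(1))
    have sK[measurable_cong]: "sets K = sets borel" using K by (rule invariant_measureD(2))
    have [measurable]: "U n \<in> borel_measurable borel" for n using U by blast
    have "(\<lambda>n. LINT x|K. U n x - U n 0) \<longlonglongrightarrow> (LINT x|K. 0)"
    proof (rule integral_dominated_convergence[where w = "\<lambda>_. 1"])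
      show "AE x in K. (\<lambda>n. U n x - U n 0) \<longlonglongrightarrow> 0"
      proof (rule AE_I2)
        fix x :: "real^'n"
        have "(\<lambda>n. C * c ^ n * dist x 0) \<longlonglongrightarrow> C * 0 * dist x 0"
          using c by (intro tendsto_intros LIMSEQ_power_zero) auto
        then have "(\<lambda>n. C * c ^ n * dist x 0) \<longlonglongrightarrow> 0" by simp
        moreover have "\<forall>\<^sub>F n in sequentially. norm (U n x - U n 0) \<le> C * c ^ n * dist x 0"
        proof (rule always_eventually, rule allI)
          fix n
          have "\<bar>U n x - U n 0\<bar> \<le> C * c ^ n * dist x 0" using U[of n] by blast
          then show "norm (U n x - U n 0) \<le> C * c ^ n * dist x 0" by simp
        qed
        ultimately show "(\<lambda>n. U n x - U n 0) \<longlonglongrightarrow> 0"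
          by (rule Lim_null_comparison[rotated])
      qed
      show "AE x in K. norm (U n x - U n 0) \<le> 1" for n
      proof (rule AE_I2)
        fix x :: "real^'n"
        have "0 \<le> U n x \<and> U n x \<le> 1" "0 \<le> U n 0 \<and> U n 0 \<le> 1" using U[of n] by blast+
        then show "norm (U n x - U n 0) \<le> 1" by auto
      qed
    qed auto
    moreover have "(LINT x|K. U n x - U n 0) = (LINT x|K. f x) - U n 0" for n
    proof -
      have "\<bar>U n x\<bar> \<le> 1" for x using U[of n] by (simp add: abs_of_nonneg)
      then have "integrable K (U n)" by (intro integrable_bounded[where C = 1]) auto
      moreover have "(LINT x|K. U n x) = (LINT x|K. f x)" using U[of n] K by blast
      ultimately show ?thesis by (simp add: prob_space)
    qed
    ultimately have "(\<lambda>n. (LINT x|K. f x) - U n 0) \<longlonglongrightarrow> 0" by simp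
    then show ?thesis
      using Lim_transform2[of "\<lambda>_. LINT x|K. f x" _ sequentially "\<lambda>n. U n 0"] by simp
  qed
  show "(LINT x|M. f x) = (LINT x|N. f x)"
    using LIMSEQ_unique[OF lim[OF M] lim[OF N]] .
qed (use invariant_measureD(1,2)[OF M] invariant_measureD(1,2)[OF N] in auto)

definition digit_sum :: "real^'n^'n \<Rightarrow> (real^'n) stream \<Rightarrow> real^'n" where
  "digit_sum A s = (\<Sum>k. ((*v) A ^^ k) (s !! k))"

lemma norm_funpow_le:
  fixes T :: "'a::real_normed_vector \<Rightarrow> 'a"
  assumes "0 \<le> c" "\<And>x. norm (T x) \<le> c * norm x"
  shows "norm ((T ^^ k) x) \<le> c ^ k * norm x"
proof (induction k)
  case (Suc k)
  have "norm ((T ^^ Suc k) x) \<le> c * norm ((T ^^ k) x)" using assms(2) by simp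
  also have "\<dots> \<le> c * (c ^ k * norm x)" using Suc assms(1) by (intro mult_left_mono)
  finally show ?case by simp
qed simp

lemma digit_sum_bounds:
  fixes A :: "real^'n^'n"
  assumes c: "0 \<le> c" "c < 1" and contr: "\<And>x. norm (A *v x) \<le> c * norm x"
    and \<beta>: "\<And>b. b \<in> B \<Longrightarrow> norm b \<le> \<beta>" and s: "s \<in> streams B"
  shows "summable (\<lambda>k. ((*v) A ^^ k) (s !! k))" "norm (digit_sum A s) \<le> \<beta> / (1 - c)"
proof -
  have le: "norm (((*v) A ^^ k) (s !! k)) \<le> \<beta> * c ^ k" for k
  proof -
    have "s !! k \<in> B" using s by (simp add: streams_iff_snth)
    then have "c ^ k * norm (s !! k) \<le> c ^ k * \<beta>" using c \<beta> by (intro mult_left_mono) auto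
    then show ?thesis
      using norm_funpow_le[where T = "(*v) A", OF c(1) contr, of k "s !! k"] by (simp add: mult.commute)
  qed
  have geo: "summable (\<lambda>k. \<beta> * c ^ k)" using c by (intro summable_mult summable_geometric) auto
  show "summable (\<lambda>k. ((*v) A ^^ k) (s !! k))"
    by (rule summable_comparison_test'[OF geo le])
  have "norm (digit_sum A s) \<le> (\<Sum>k. \<beta> * c ^ k)"
    unfolding digit_sum_def by (rule norm_suminf_le[OF le geo])
  also have "\<dots> = \<beta> / (1 - c)" using c by (simp add: suminf_mult suminf_geometric)
  finally show "norm (digit_sum A s) \<le> \<beta> / (1 - c)" .
qed

lemma digit_sum_Stream:
  assumes "summable (\<lambda>k. ((*v) A ^^ k) (s !! k))"
    and "summable (\<lambda>k. ((*v) A ^^ k) ((b ## s) !! k))"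
  shows "digit_sum A (b ## s) = A *v digit_sum A s + b"
proof -
  have "digit_sum A (b ## s) = b + (\<Sum>k. A *v (((*v) A ^^ k) (s !! k)))"
    using suminf_split_head[OF assms(2)] by (simp add: digit_sum_def)
  also have "(\<Sum>k. A *v (((*v) A ^^ k) (s !! k))) = A *v digit_sum A s"
    unfolding digit_sum_def
    by (rule bounded_linear.suminf[OF _ assms(1), symmetric])
       (simp add: linear_linear[symmetric] matrix_vector_mul_linear)
  finally show ?thesis by simp
qed

text \<open>The invariant measure is the law of the random series \<open>\<Sum>k. A^k b\<^sub>k\<close> with independent
  uniformly distributed digits: prepending a digit to the sequence acts on the sum as one of the
  maps of the system.\<close>
lemma invariant_measure_exists:
  fixes R :: "real^'n^'n"
  assumes B: "finite B" "B \<noteq> {}" and c: "0 \<le> c" "c < 1"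
    and contr: "\<And>x. norm (matrix_inv (real r *\<^sub>R R) *v x) \<le> c * norm x"
    and \<beta>: "\<And>b. b \<in> B \<Longrightarrow> norm b \<le> \<beta>"
  shows "\<exists>M. is_invariant_measure R B r M \<and> (AE x in M. norm x \<le> \<beta> / (1 - c))"
proof -
  let ?A = "matrix_inv (real r *\<^sub>R R)"
  let ?U = "uniform_count_measure B"
  interpret U: prob_space ?U using B by (rule prob_space_uniform_count_measure)
  interpret S: prob_space "stream_space ?U" by (rule U.prob_space_stream_space)
  have spS: "space (stream_space ?U) = streams B"
    by (simp add: space_stream_space space_uniform_count_measure)
  have any: "f \<in> ?U \<rightarrow>\<^sub>M borel" for f :: "real^'n \<Rightarrow> real^'n"
    by (auto simp: measurable_def sets_uniform_count_measure space_uniform_count_measure)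
  have "(\<lambda>s. ((*v) ?A ^^ k) (s !! k)) \<in> stream_space ?U \<rightarrow>\<^sub>M borel" for k
    by (rule measurable_compose[OF measurable_snth any])
  then have F[measurable]: "digit_sum ?A \<in> stream_space ?U \<rightarrow>\<^sub>M borel"
    unfolding digit_sum_def[abs_def] by (rule borel_measurable_suminf)
  define M where "M = distr (stream_space ?U) borel (digit_sum ?A)"
  have M: "prob_space M" unfolding M_def by (rule S.prob_space_distr[OF F])
  interpret M: prob_space M by (rule M)
  note bounds = digit_sum_bounds[OF c contr \<beta>]
  have shift: "digit_sum ?A (b ## s) = sigma R r b (digit_sum ?A s)" if "b \<in> B" "s \<in> streams B" for b s
    unfolding sigma_def
    by (rule digit_sum_Stream) (use bounds(1) that in \<open>auto simp: streams_Stream\<close>)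
  have "measure M X = (1 / real (card B)) * (\<Sum>b\<in>B. measure M (sigma R r b -` X))"
    if [measurable]: "X \<in> sets borel" for X
  proof -
    let ?Y = "digit_sum ?A -` X \<inter> space (stream_space ?U)"
    have Y: "?Y \<in> sets (stream_space ?U)" by measurable
    have "emeasure M X = emeasure (stream_space ?U) ?Y"
      unfolding M_def by (rule emeasure_distr) auto
    also have "\<dots> = (\<integral>\<^sup>+b. emeasure (stream_space ?U) {s \<in> space (stream_space ?U). b ## s \<in> ?Y} \<partial>?U)"
      by (rule U.emeasure_stream_space[OF Y])
    also have "\<dots> = (\<integral>\<^sup>+b. emeasure M (sigma R r b -` X) \<partial>?U)"
    proof (rule nn_integral_cong)
      fix b assume "b \<in> space ?U"
      then have b: "b \<in> B" by (simp add: space_uniform_count_measure)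
      have pre: "sigma R r b -` X \<in> sets borel"
        using measurable_sets[OF borel_measurable_sigma \<open>X \<in> sets borel\<close>] by simp
      have "{s \<in> space (stream_space ?U). b ## s \<in> ?Y}
        = digit_sum ?A -` (sigma R r b -` X) \<inter> space (stream_space ?U)"
        using b shift by (auto simp: spS streams_Stream)
      then show "emeasure (stream_space ?U) {s \<in> space (stream_space ?U). b ## s \<in> ?Y}
        = emeasure M (sigma R r b -` X)"
        unfolding M_def by (simp only: emeasure_distr[OF F pre])
    qed
    also have "\<dots> = (\<Sum>b\<in>B. ennreal (1 / real (card B)) * ennreal (measure M (sigma R r b -` X)))"
      using B by (simp add: M.emeasure_eq_measure uniform_count_measure_def nn_integral_point_measure_finite)
    also have "\<dots> = ennreal ((1 / real (card B)) * (\<Sum>b\<in>B. measure M (sigma R r b -` X)))"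
      by (simp add: ennreal_mult[symmetric] sum_distrib_left)
    finally show ?thesis
      by (simp add: M.emeasure_eq_measure sum_nonneg)
  qed
  then have "is_invariant_measure R B r M"
    using M by (simp add: is_invariant_measure_def M_def)
  moreover have "AE x in M. norm x \<le> \<beta> / (1 - c)"
    unfolding M_def
    by (subst AE_distr_iff[OF F]) (use bounds(2) in \<open>auto intro!: AE_I2 simp: spS\<close>)
  ultimately show ?thesis by blast
qed

lemma invariant_measure_mu:
  fixes R :: "real^'n^'n"
  assumes B: "finite B" "B \<noteq> {}" and c: "0 \<le> c" "c < 1"
    and contr: "\<And>x. norm (matrix_inv (real r *\<^sub>R R) *v x) \<le> c * norm x"
    and \<beta>: "\<And>b. b \<in> B \<Longrightarrow> norm b \<le> \<beta>"
  shows "is_invariant_measure R B r (mu R B r)" "AE x in mu R B r. norm x \<le> \<beta> / (1 - c)"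
proof -
  obtain M where M: "is_invariant_measure R B r M" "AE x in M. norm x \<le> \<beta> / (1 - c)"
    using invariant_measure_exists[OF B c contr \<beta>] by blast
  have "mu R B r = M"
    unfolding mu_def using M(1) invariant_measure_unique[OF B c contr _ M(1)] by (rule the_equality)
  then show "is_invariant_measure R B r (mu R B r)" "AE x in mu R B r. norm x \<le> \<beta> / (1 - c)"
    using M by auto
qed

section \<open>The Fourier transform of the invariant measure\<close>

definition ft :: "(real^'n) measure \<Rightarrow> real^'n \<Rightarrow> complex" where
  "ft M t = (LINT x|M. expo t x)"

text \<open>The symbol of the system: the Fourier transform of the uniform distribution on \<open>B\<close>.\<close>
definition chi :: "(real^'n) set \<Rightarrow> real^'n \<Rightarrow> complex" where
  "chi B t = (\<Sum>b\<in>B. expo t b) / of_nat (card B)"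

lemma expo_matrix: "expo t (A *v x) = expo (transpose A *v t) x"
  by (simp add: expo_def transpose_matrix_vector dot_lmul_matrix)

text \<open>The translation by \<open>b\<close> contributes the factor \<open>expo t b\<close>, and the linear part passes to the
  frequency as its transpose.\<close>
lemma ft_invariant_measure:
  assumes M: "is_invariant_measure R B r M" and B: "finite B" "B \<noteq> {}"
  shows "ft M t = chi B t * ft M (transpose (matrix_inv (real r *\<^sub>R R)) *v t)"
proof -
  have "ft M t = (\<Sum>b\<in>B. LINT x|M. expo t (sigma R r b x)) / of_nat (card B)"
    unfolding ft_def by (rule invariant_measure_integral_complex[OF M B, where C = 1]) auto
  also have "\<dots> = (\<Sum>b\<in>B. expo t b * ft M (transpose (matrix_inv (real r *\<^sub>R R)) *v t)) / of_nat (card B)"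
    unfolding ft_def by (simp add: sigma_def expo_add_right expo_matrix mult.commute)
  finally show ?thesis by (simp add: chi_def sum_distrib_right)
qed

lemma norm_expo_minus_one: "cmod (expo t x - 1) \<le> 2 * pi * (norm t * norm x)"
proof -
  have "cmod (expo t x - 1) \<le> \<bar>2 * pi * (t \<bullet> x)\<bar>"
    using iexp_approx1[of "2 * pi * (t \<bullet> x)" 0] by (simp add: expo_def)
  also have "\<dots> \<le> 2 * pi * (norm t * norm x)"
    using Cauchy_Schwarz_ineq2[of t x] by (simp add: abs_mult)
  finally show ?thesis .
qed

text \<open>The Fourier transform stays close to one near the origin at a rate governed by the size of the
  support alone; this is what makes the choice of the dilation uniform.\<close>
lemma ft_bounds:
  fixes M :: "(real^'n) measure"
  assumes "prob_space M" and sM: "sets M = sets borel" and K: "AE x in M. norm x \<le> K"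
  shows "cmod (ft M t) \<le> 1" "1 - (cmod (ft M t))\<^sup>2 \<le> 4 * pi * K * norm t"
proof -
  interpret prob_space M by fact
  note [measurable_cong] = sM
  have int: "integrable M (expo t)" by (rule integrable_bounded[where C = 1]) auto
  have "cmod (ft M t) \<le> (LINT x|M. cmod (expo t x))"
    unfolding ft_def by (rule integral_norm_bound)
  then show le1: "cmod (ft M t) \<le> 1" by (simp add: prob_space)
  have "cmod (ft M t - 1) = cmod (LINT x|M. expo t x - 1)"
    using int by (simp add: ft_def prob_space)
  also have "\<dots> \<le> (LINT x|M. cmod (expo t x - 1))"
    by (rule integral_norm_bound)
  also have "\<dots> \<le> (LINT x|M. 2 * pi * (norm t * K))"
  proof (rule integral_mono_AE)
    show "AE x in M. cmod (expo t x - 1) \<le> 2 * pi * (norm t * K)"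
      using K
    proof eventually_elim
      case (elim x)
      have "2 * pi * (norm t * norm x) \<le> 2 * pi * (norm t * K)"
        using elim by (intro mult_left_mono) auto
      then show ?case using norm_expo_minus_one[of t x] by linarith
    qed
  qed (use int in auto)
  finally have "cmod (ft M t - 1) \<le> 2 * pi * (norm t * K)" by (simp add: prob_space)
  moreover have "1 - cmod (ft M t) \<le> cmod (ft M t - 1)"
    using norm_triangle_ineq2[of 1 "ft M t"] by (simp add: norm_minus_commute)
  moreover have "1 - (cmod (ft M t))\<^sup>2 \<le> 2 * (1 - cmod (ft M t))"
    using zero_le_power2[of "1 - cmod (ft M t)"] by (simp add: power2_eq_square algebra_simps)
  ultimately show "1 - (cmod (ft M t))\<^sup>2 \<le> 4 * pi * K * norm t" by (simp add: algebra_simps)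
qed

section \<open>Iteration of the transfer operator\<close>

text \<open>Iterates of the Ruelle transfer operator with weight \<open>p\<close> and inverse branches
  \<open>t \<mapsto> T (t - l)\<close>, applied to \<open>h\<close>.\<close>
primrec transfer_iter ::
    "('a::ab_group_add \<Rightarrow> real) \<Rightarrow> ('a \<Rightarrow> 'a) \<Rightarrow> 'a set \<Rightarrow> ('a \<Rightarrow> real) \<Rightarrow> nat \<Rightarrow> 'a \<Rightarrow> real" where
  "transfer_iter p T L h 0 t = h t"
| "transfer_iter p T L h (Suc n) t = (\<Sum>l\<in>L. p (t - l) * transfer_iter p T L h n (T (t - l)))"

text \<open>The weights \<open>p (t - l)\<close> are the transition probabilities of a Markov chain on frequencies, and
  \<open>h t\<close> is the probability that the chain started at \<open>t\<close> takes the branch \<open>l = 0\<close> forever. The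
  iterates increase to the probability \<open>Q t\<close> of choosing \<open>0\<close> from some time on. Near the origin
  \<open>h \<ge> 1/2\<close>: from every point of a small ball, which all branches map into itself, the chain has at
  least an even chance never to leave the branch \<open>0\<close>. Hence the supremum over the ball of the defect
  \<open>q = 1 - Q\<close> is at most half of itself, and \<open>q\<close> vanishes on the ball. As every branch
  maps the ball of twice the radius into the ball, \<open>q\<close> then vanishes on larger and larger balls.\<close>
lemma transfer_iter_tendsto_1:
  fixes T :: "'a::real_normed_vector \<Rightarrow> 'a"
  assumes L: "finite L" "0 \<in> L" "\<And>l. l \<in> L \<Longrightarrow> norm l \<le> m"
    and p: "\<And>t. 0 \<le> p t" "\<And>t. (\<Sum>l\<in>L. p (t - l)) = 1"
    and h: "\<And>t. 0 \<le> h t" "\<And>t. h t \<le> 1" "\<And>t. h t = p t * h (T t)"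
    and h0: "\<And>t. 1 - h t \<le> \<kappa> * norm t" and \<kappa>: "0 \<le> \<kappa>"
    and c: "0 \<le> c" "\<And>x. norm (T x) \<le> c * norm x"
    and \<rho>: "0 < \<rho>" "\<kappa> * \<rho> \<le> 1 / 2" "c * (2 * \<rho> + m) \<le> \<rho>"
  shows "(\<lambda>n. transfer_iter p T L h n t) \<longlonglongrightarrow> 1"
proof -
  let ?Q = "transfer_iter p T L h"
  have m: "0 \<le> m" using L(3)[OF L(2)] by simp
  have c1: "c < 1"
  proof -
    have "c * (2 * \<rho>) \<le> c * (2 * \<rho> + m)" using c m by (intro mult_left_mono) auto
    also have "\<dots> \<le> \<rho>" by (rule \<rho>(3))
    finally have "(2 * c) * \<rho> \<le> 1 * \<rho>" by (simp add: algebra_simps)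
    then have "2 * c \<le> 1" by (rule mult_right_le_imp_le[OF _ \<rho>(1)])
    then show ?thesis by simp
  qed
  have Q01: "0 \<le> ?Q n t \<and> ?Q n t \<le> 1" for n t
  proof (induction n arbitrary: t)
    case (Suc n)
    have "(\<Sum>l\<in>L. p (t - l) * ?Q n (T (t - l))) \<le> (\<Sum>l\<in>L. p (t - l) * 1)"
      using Suc p by (intro sum_mono mult_left_mono) auto
    then show ?case using Suc p by (auto intro!: sum_nonneg mult_nonneg_nonneg)
  qed (use h(1,2) in auto)
  have Qmono: "?Q n t \<le> ?Q (Suc n) t" for n t
  proof (induction n arbitrary: t)
    case 0
    have "p (t - 0) * h (T (t - 0)) \<le> (\<Sum>l\<in>L. p (t - l) * h (T (t - l)))"
      by (rule member_le_sum[OF L(2)]) (use p(1) h(1) L(1) in \<open>auto intro!: mult_nonneg_nonneg\<close>)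
    then show ?case using h(3)[of t] by simp
  next
    case (Suc n)
    have "(\<Sum>l\<in>L. p (t - l) * ?Q n (T (t - l))) \<le> (\<Sum>l\<in>L. p (t - l) * ?Q (Suc n) (T (t - l)))"
      using Suc p by (intro sum_mono mult_left_mono) auto
    then show ?case by simp
  qed
  have "\<exists>y. (\<lambda>n. ?Q n t) \<longlonglongrightarrow> y" for t
  proof -
    have "incseq (\<lambda>n. ?Q n t)" using Qmono by (intro incseq_SucI)
    then show ?thesis using Q01[of _ t] incseq_convergent[of "\<lambda>n. ?Q n t" 1] by metis
  qed
  then obtain Q where Q: "\<And>t. (\<lambda>n. ?Q n t) \<longlonglongrightarrow> Q t" by metis
  \<comment> \<open>The defect, a bounded fixed point of the transfer operator that vanishes at the origin.\<close>
  define q where "q t = 1 - Q t" for t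
  have q_nonneg: "0 \<le> q t" for t
    using LIMSEQ_le_const2[OF Q, of t 1] Q01[of _ t] by (auto simp: q_def)
  have q_le1: "q t \<le> 1" for t
    using LIMSEQ_le_const[OF Q, of 0 t] Q01[of _ t] by (auto simp: q_def)
  have q_le: "q t \<le> \<kappa> * norm t" for t
  proof -
    have "?Q 0 t \<le> ?Q n t" for n by (rule lift_Suc_mono_le[of "\<lambda>n. ?Q n t"]) (use Qmono in auto)
    then have "h t \<le> Q t" using LIMSEQ_le_const[OF Q, of "h t" t] by auto
    then show ?thesis using h0[of t] by (simp add: q_def)
  qed
  have q_fix: "q t = (\<Sum>l\<in>L. p (t - l) * q (T (t - l)))" for t
  proof -
    have "(\<lambda>n. ?Q (Suc n) t) \<longlonglongrightarrow> (\<Sum>l\<in>L. p (t - l) * Q (T (t - l)))"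
      unfolding transfer_iter.simps by (intro tendsto_intros Q)
    then have "Q t = (\<Sum>l\<in>L. p (t - l) * Q (T (t - l)))"
      using LIMSEQ_unique[OF LIMSEQ_Suc[OF Q]] by blast
    then show ?thesis using p(2)[of t] by (simp add: q_def right_diff_distrib sum_subtractf)
  qed
  have p_le1: "p t \<le> 1" for t
    using member_le_sum[OF L(2), of "\<lambda>l. p (t - l)"] p L(1) by simp
  have shrink: "norm (T (t - l)) \<le> \<rho>" if "norm t \<le> \<rho>" "l \<in> L" for t l
  proof -
    have "norm (T (t - l)) \<le> c * norm (t - l)" by (rule c)
    also have "\<dots> \<le> c * (2 * \<rho> + m)"
      using norm_triangle_ineq4[of t l] L(3)[OF that(2)] that \<rho>(1) c(1) by (intro mult_left_mono) auto
    finally show ?thesis using \<rho> by simp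
  qed
  have halve: "q t \<le> a / 2" if a: "\<And>s. norm s \<le> \<rho> \<Longrightarrow> q s \<le> a" and t: "norm t \<le> \<rho>" for a t
  proof -
    have a0: "0 \<le> a" using a[of 0] q_nonneg[of 0] \<rho>(1) by simp
    \<comment> \<open>The probability of staying on the branch \<open>0\<close> for the first \<open>k\<close> steps.\<close>
    define P where "P k = (\<Prod>j<k. p ((T ^^ j) t))" for k
    have P01: "0 \<le> P k" "P k \<le> 1" for k
      unfolding P_def using p(1) p_le1 by (auto intro!: prod_nonneg prod_le_1)
    have Ph: "P k * h ((T ^^ k) t) = h t" for k
    proof (induction k)
      case (Suc k)
      have "P (Suc k) * h ((T ^^ Suc k) t) = P k * (p ((T ^^ k) t) * h (T ((T ^^ k) t)))"
        by (simp add: P_def)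
      also have "\<dots> = P k * h ((T ^^ k) t)" by (simp only: h(3)[of "(T ^^ k) t", symmetric])
      finally show ?case using Suc by simp
    qed (simp add: P_def)
    have ball: "norm ((T ^^ k) t) \<le> \<rho>" for k
    proof (induction k)
      case (Suc k)
      then show ?case using shrink[OF Suc L(2)] by simp
    qed (use t in simp)
    have main: "q t \<le> (1 - P k) * a + P k * q ((T ^^ k) t)" for k
    proof (induction k)
      case (Suc k)
      let ?s = "(T ^^ k) t"
      have "q ?s = p ?s * q (T ?s) + (\<Sum>l\<in>L - {0}. p (?s - l) * q (T (?s - l)))"
        using q_fix[of ?s] sum.remove[OF L(1,2), of "\<lambda>l. p (?s - l) * q (T (?s - l))"] by simp
      also have "\<dots> \<le> p ?s * q (T ?s) + (\<Sum>l\<in>L - {0}. p (?s - l) * a)"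
        using ball[of k] p(1) a shrink by (intro add_left_mono sum_mono mult_left_mono) auto
      also have "(\<Sum>l\<in>L - {0}. p (?s - l) * a) = (1 - p ?s) * a"
        using p(2)[of ?s] sum.remove[OF L(1,2), of "\<lambda>l. p (?s - l)"]
        by (simp add: sum_distrib_right[symmetric])
      finally have "P k * q ?s \<le> P k * (p ?s * q (T ?s) + (1 - p ?s) * a)"
        using P01 by (intro mult_left_mono) auto
      then have "q t \<le> (1 - P k) * a + P k * (p ?s * q (T ?s) + (1 - p ?s) * a)"
        using Suc by linarith
      also have "\<dots> = (1 - P (Suc k)) * a + P (Suc k) * q ((T ^^ Suc k) t)"
        by (simp add: P_def algebra_simps)
      finally show ?case .
    qed (simp add: P_def)
    have P_half: "1 / 2 \<le> P k" for k
    proof -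
      have "\<kappa> * norm t \<le> \<kappa> * \<rho>" using \<kappa> t by (intro mult_left_mono)
      then have "1 / 2 \<le> h t" using h0[of t] \<rho>(2) by linarith
      also have "h t \<le> P k" unfolding Ph[of k, symmetric] using P01 h(1,2) by (intro mult_left_le) auto
      finally show ?thesis .
    qed
    have bound: "q t \<le> a / 2 + \<kappa> * (c ^ k * norm t)" for k
    proof -
      have "(1 - P k) * a \<le> 1 / 2 * a" using P_half[of k] a0 by (intro mult_right_mono) auto
      moreover have "P k * q ((T ^^ k) t) \<le> q ((T ^^ k) t)"
        using P01 q_nonneg by (intro mult_left_le_one_le) auto
      moreover have "q ((T ^^ k) t) \<le> \<kappa> * (c ^ k * norm t)"
        using q_le[of "(T ^^ k) t"] mult_left_mono[OF norm_funpow_le[of c T k t, OF c] \<kappa>] by linarith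
      ultimately show ?thesis using main[of k] by linarith
    qed
    have "(\<lambda>k. a / 2 + \<kappa> * (c ^ k * norm t)) \<longlonglongrightarrow> a / 2 + \<kappa> * (0 * norm t)"
      using c c1 by (intro tendsto_intros LIMSEQ_power_zero) auto
    then show "q t \<le> a / 2"
      using LIMSEQ_le_const[of _ _ "q t"] bound by fastforce
  qed
  have small: "q t \<le> (1 / 2) ^ k" if "norm t \<le> \<rho>" for t k
    using that
  proof (induction k arbitrary: t)
    case (Suc k)
    then show ?case using halve[of "(1 / 2) ^ k" t] by simp
  qed (use q_le1 in simp)
  have q0: "q t = 0" if "norm t \<le> \<rho>" for t
  proof -
    have "(\<lambda>k. (1 / 2) ^ k :: real) \<longlonglongrightarrow> 0" by (rule LIMSEQ_power_zero) simp
    then have "q t \<le> 0" using LIMSEQ_le_const[of _ 0 "q t"] small[OF that] by blast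
    then show ?thesis using q_nonneg[of t] by simp
  qed
  have all0: "q t = 0" if "norm t \<le> 2 ^ k * \<rho>" for t k
    using that
  proof (induction k arbitrary: t)
    case (Suc k)
    have "q (T (t - l)) = 0" if l: "l \<in> L" for l
    proof (rule Suc.IH)
      have "m \<le> 2 ^ k * m" using m mult_right_mono[of 1 "2 ^ k" m] by simp
      then have "norm (t - l) \<le> 2 ^ k * (2 * \<rho> + m)"
        using norm_triangle_ineq4[of t l] L(3)[OF l] Suc.prems by (simp add: algebra_simps)
      then have "c * norm (t - l) \<le> c * (2 ^ k * (2 * \<rho> + m))" using c by (intro mult_left_mono)
      also have "\<dots> = 2 ^ k * (c * (2 * \<rho> + m))" by simp
      also have "\<dots> \<le> 2 ^ k * \<rho>" using \<rho>(3) by (intro mult_left_mono) auto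
      finally show "norm (T (t - l)) \<le> 2 ^ k * \<rho>" using c(2)[of "t - l"] by linarith
    qed
    then show ?case using q_fix[of t] by simp
  qed (use q0 in simp)
  obtain k where "norm t / \<rho> < 2 ^ k" using real_arch_pow[of 2 "norm t / \<rho>"] by auto
  then have "norm t \<le> 2 ^ k * \<rho>" using \<rho>(1) by (simp add: pos_divide_less_eq)
  then have "Q t = 1" using all0 by (simp add: q_def)
  then show ?thesis using Q[of t] by simp
qed

section \<open>Hadamard pairs\<close>

lemma expo_commute: "expo l b = expo b l"
  by (simp add: expo_def inner_commute)

lemma hadamard_eq_expo: "hadamard B b l = complex_of_real (1 / sqrt (real (card B))) * expo l b"
  by (simp add: hadamard_def expo_def inner_commute)

lemma inverse_sqrt_sq:
  "complex_of_real (1 / sqrt (real n)) * complex_of_real (1 / sqrt (real n)) = 1 / of_nat n"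
proof -
  have "(1 / sqrt (real n)) * (1 / sqrt (real n)) = 1 / real n" by simp
  then show ?thesis by (metis of_real_mult of_real_divide of_real_1 of_real_of_nat_eq)
qed

text \<open>The two halves of unitarity as character sums: rows give the total mass of the weights, columns
  the orthogonality of frequencies with different digits.\<close>
lemma unitary_rows:
  assumes U: "unitary_on B L (hadamard B)" and b: "b \<in> B" "b' \<in> B" and B: "finite B"
  shows "(\<Sum>l\<in>L. expo (b - b') l) = (if b = b' then of_nat (card B) else 0)"
proof -
  have N: "(of_nat (card B) :: complex) \<noteq> 0" using B b by auto
  have "hadamard B b l * cnj (hadamard B b' l) = expo (b - b') l / of_nat (card B)" for l
  proof -
    have "hadamard B b l * cnj (hadamard B b' l)
      = (complex_of_real (1 / sqrt (real (card B))) * complex_of_real (1 / sqrt (real (card B))))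
          * (expo l b * cnj (expo l b'))"
      by (simp add: hadamard_eq_expo)
    then show ?thesis
      unfolding inverse_sqrt_sq by (simp add: expo_commute[of l] expo_diff)
  qed
  then have "(\<Sum>l\<in>L. expo (b - b') l / of_nat (card B))
      = (\<Sum>l\<in>L. hadamard B b l * cnj (hadamard B b' l))" by simp
  also have "\<dots> = (if b = b' then 1 else 0)"
    using U b unfolding unitary_on_def by blast
  finally have "(\<Sum>l\<in>L. expo (b - b') l / of_nat (card B)) = (if b = b' then 1 else 0)" .
  then show ?thesis using N by (simp add: sum_divide_distrib[symmetric] field_simps split: if_splits)
qed

lemma unitary_columns:
  assumes U: "unitary_on B L (hadamard B)" and l: "l \<in> L" "l' \<in> L"
  shows "chi B (l - l') = (if l = l' then 1 else 0)"
proof -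
  have "cnj (hadamard B b l') * hadamard B b l = expo (l - l') b / of_nat (card B)" for b
  proof -
    have "cnj (hadamard B b l') * hadamard B b l
      = (complex_of_real (1 / sqrt (real (card B))) * complex_of_real (1 / sqrt (real (card B))))
          * (expo l b * cnj (expo l' b))"
      by (simp add: hadamard_eq_expo)
    then show ?thesis
      unfolding inverse_sqrt_sq by (simp add: expo_diff)
  qed
  then have "(\<Sum>b\<in>B. expo (l - l') b / of_nat (card B))
      = (\<Sum>b\<in>B. cnj (hadamard B b l') * hadamard B b l)" by simp
  also have "\<dots> = (if l' = l then 1 else 0)"
    using U l unfolding unitary_on_def by blast
  finally have "(\<Sum>b\<in>B. expo (l - l') b / of_nat (card B)) = (if l' = l then 1 else 0)" .
  then show ?thesis by (auto simp: chi_def sum_divide_distrib)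
qed

text \<open>Parseval for the Hadamard matrix: the weights of the transfer operator are transition
  probabilities.\<close>
lemma sum_chi_sq:
  assumes U: "unitary_on B L (hadamard B)" and B: "finite B" "B \<noteq> {}"
  shows "(\<Sum>l\<in>L. (cmod (chi B (t - l)))\<^sup>2) = 1"
proof -
  let ?N = "of_nat (card B) :: complex"
  have N: "?N \<noteq> 0" using B by simp
  have "complex_of_real (\<Sum>l\<in>L. (cmod (chi B (t - l)))\<^sup>2) = (\<Sum>l\<in>L. chi B (t - l) * cnj (chi B (t - l)))"
    by (simp only: of_real_sum complex_norm_square)
  also have "\<dots> = (\<Sum>l\<in>L. \<Sum>b\<in>B. \<Sum>b'\<in>B. expo t (b - b') * expo (b' - b) l / ?N\<^sup>2)"
  proof (rule sum.cong[OF refl])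
    fix l
    have "expo (t - l) b * cnj (expo (t - l) b') = expo t (b - b') * expo (b' - b) l" for b b'
    proof -
      have "expo (t - l) b * cnj (expo (t - l) b') = expo (t - l) (b - b')"
        by (metis expo_commute expo_diff)
      also have "\<dots> = expo t (b - b') * expo (- l) (b - b')"
        using expo_add[of t "- l"] by simp
      also have "expo (- l) (b - b') = expo (b' - b) l"
        by (metis cnj_expo expo_commute minus_diff_eq minus_minus)
      finally show ?thesis .
    qed
    then show "chi B (t - l) * cnj (chi B (t - l))
      = (\<Sum>b\<in>B. \<Sum>b'\<in>B. expo t (b - b') * expo (b' - b) l / ?N\<^sup>2)"
      by (simp add: chi_def sum_product power2_eq_square sum_divide_distrib[symmetric])
  qed
  also have "\<dots> = (\<Sum>b\<in>B. \<Sum>l\<in>L. \<Sum>b'\<in>B. expo t (b - b') * expo (b' - b) l / ?N\<^sup>2)"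
    by (rule sum.swap)
  also have "\<dots> = (\<Sum>b\<in>B. \<Sum>b'\<in>B. \<Sum>l\<in>L. expo t (b - b') * expo (b' - b) l / ?N\<^sup>2)"
    by (intro sum.cong refl sum.swap)
  also have "\<dots> = (\<Sum>b\<in>B. \<Sum>b'\<in>B. if b' = b then 1 / ?N else 0)"
  proof (intro sum.cong refl)
    fix b b' assume "b \<in> B" "b' \<in> B"
    have "(\<Sum>l\<in>L. expo t (b - b') * expo (b' - b) l / ?N\<^sup>2)
      = expo t (b - b') * (\<Sum>l\<in>L. expo (b' - b) l) / ?N\<^sup>2"
      by (simp add: sum_distrib_left sum_divide_distrib)
    then show "(\<Sum>l\<in>L. expo t (b - b') * expo (b' - b) l / ?N\<^sup>2) = (if b' = b then 1 / ?N else 0)"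
      using unitary_rows[OF U \<open>b' \<in> B\<close> \<open>b \<in> B\<close> B(1)] N
      by (simp add: power2_eq_square expo_def)
  qed
  also have "\<dots> = 1" using B(1) N by simp
  finally show ?thesis by (metis of_real_eq_1_iff)
qed

section \<open>The frequencies\<close>

text \<open>The frequencies with \<open>n\<close> digits. The recursion strips the lowest digit, which is what one step
  of the two-scale equation does.\<close>
primrec frequencies :: "real^'n^'n \<Rightarrow> (real^'n) set \<Rightarrow> nat \<Rightarrow> (real^'n) set" where
  "frequencies S L 0 = {0}"
| "frequencies S L (Suc n) = (\<lambda>(l, \<nu>). l + S *v \<nu>) ` (L \<times> frequencies S L n)"

lemma finite_frequencies: "finite L \<Longrightarrow> finite (frequencies S L n)"
  by (induction n) auto

lemma matrix_vector_mult_sum: "A *v (\<Sum>i\<in>I. f i) = (\<Sum>i\<in>I. A *v f i)"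
  for A :: "real^'n^'m"
  by (rule linear_sum) (rule matrix_vector_mul_linear)

lemma frequencies_eq:
  "frequencies S L n = {(\<Sum>k<n. matpow S k *v l k) | l. \<forall>k<n. l k \<in> L}"
proof (induction n)
  case (Suc n)
  have shift: "(\<Sum>k<Suc n. matpow S k *v l k) = l 0 + S *v (\<Sum>k<n. matpow S k *v l (Suc k))" for l
    by (subst sum.lessThan_Suc_shift)
       (simp add: matrix_vector_mult_sum matrix_vector_mul_assoc)
  show ?case
  proof (intro equalityI subsetI)
    fix x assume "x \<in> frequencies S L (Suc n)"
    then obtain l0 l where x: "l0 \<in> L" "\<forall>k<n. l k \<in> L" "x = l0 + S *v (\<Sum>k<n. matpow S k *v l k)"
      using Suc by auto
    then have "x = (\<Sum>k<Suc n. matpow S k *v case_nat l0 l k)" "\<forall>k<Suc n. case_nat l0 l k \<in> L"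
      unfolding shift by (auto split: nat.split)
    then show "x \<in> {(\<Sum>k<Suc n. matpow S k *v l k) | l. \<forall>k<Suc n. l k \<in> L}" by blast
  next
    fix x assume "x \<in> {(\<Sum>k<Suc n. matpow S k *v l k) | l. \<forall>k<Suc n. l k \<in> L}"
    then obtain l where l: "\<forall>k<Suc n. l k \<in> L" "x = l 0 + S *v (\<Sum>k<n. matpow S k *v l (Suc k))"
      unfolding shift by auto
    then have "(\<Sum>k<n. matpow S k *v l (Suc k)) \<in> frequencies S L n" unfolding Suc by force
    then show "x \<in> frequencies S L (Suc n)" using l by auto
  qed
qed simp

lemma frequencies_mono:
  assumes "0 \<in> L" "m \<le> n"
  shows "frequencies S L m \<subseteq> frequencies S L n"
proof (rule lift_Suc_mono_le[OF _ \<open>m \<le> n\<close>])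
  fix n
  show "frequencies S L n \<subseteq> frequencies S L (Suc n)"
  proof (induction n)
    case 0
    then show ?case using \<open>0 \<in> L\<close> by (auto intro!: image_eqI[of _ _ "(0, 0)"])
  next
    case (Suc n)
    show ?case
      unfolding frequencies.simps(2)[of S L n] frequencies.simps(2)[of S L "Suc n"]
      using Suc by (intro image_mono Sigma_mono) auto
  qed
qed

lemma spectrum_set_eq_frequencies:
  assumes "0 \<in> L"
  shows "spectrum_set R L r = (\<Union>n. frequencies (real r *\<^sub>R transpose R) L n)"
proof -
  let ?S = "real r *\<^sub>R transpose R"
  have "spectrum_set R L r = (\<Union>n\<in>{1..}. frequencies ?S L (Suc n))"
    unfolding spectrum_set_def frequencies_eq
    by (fastforce simp: lessThan_Suc_atMost less_Suc_eq_le atLeast0AtMost)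
  also have "\<dots> = (\<Union>n. frequencies ?S L n)"
  proof (intro equalityI subsetI)
    fix x assume "x \<in> (\<Union>n. frequencies ?S L n)"
    then obtain n where "x \<in> frequencies ?S L n" by auto
    then have "x \<in> frequencies ?S L (Suc (Suc n))"
      using frequencies_mono[OF assms, of n "Suc (Suc n)" ?S] by auto
    then show "x \<in> (\<Union>n\<in>{1..}. frequencies ?S L (Suc n))" by force
  qed blast
  finally show ?thesis .
qed

lemma matpow_commute: "matpow R k ** R = R ** matpow R k"
  by (induction k) (simp_all add: matrix_mul_assoc[symmetric])

text \<open>Transposition moves the powers to the other side of the inner product, where the integrality
  hypothesis speaks about them.\<close>
lemma inner_matpow_transpose:
  "(matpow (c *\<^sub>R transpose R) k *v x) \<bullet> y = c ^ k * ((matpow R k *v y) \<bullet> x)"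
proof (induction k arbitrary: y)
  case (Suc k)
  have "(matpow (c *\<^sub>R transpose R) (Suc k) *v x) \<bullet> y
    = c * ((transpose R *v (matpow (c *\<^sub>R transpose R) k *v x)) \<bullet> y)"
    by (simp add: matrix_vector_mul_assoc[symmetric] scaleR_matrix_vector_assoc[symmetric])
  also have "\<dots> = c * ((matpow (c *\<^sub>R transpose R) k *v x) \<bullet> (R *v y))"
    by (simp add: transpose_matrix_vector dot_lmul_matrix)
  also have "\<dots> = c ^ Suc k * ((matpow R (Suc k) *v y) \<bullet> x)"
    unfolding Suc by (simp add: matrix_vector_mul_assoc matpow_commute)
  finally show ?case .
qed (simp add: inner_commute)

lemma expo_int: "l \<bullet> b \<in> \<int> \<Longrightarrow> expo l b = 1"
  using exp_integer_2pi[of "l \<bullet> b"] by (simp add: expo_def mult_ac)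

lemma frequencies_integral:
  assumes int: "\<And>n b l. n \<ge> 1 \<Longrightarrow> b \<in> B \<Longrightarrow> l \<in> L \<Longrightarrow> (matpow R n *v b) \<bullet> l \<in> \<int>"
    and S: "S = real r *\<^sub>R transpose R"
    and \<nu>: "\<nu> \<in> frequencies S L n" and b: "b \<in> B"
  shows "(S *v \<nu>) \<bullet> b \<in> \<int>"
proof -
  obtain l where l: "\<nu> = (\<Sum>k<n. matpow S k *v l k)" "\<forall>k<n. l k \<in> L"
    using \<nu> unfolding frequencies_eq by auto
  have "(S *v \<nu>) \<bullet> b = (\<Sum>k<n. (matpow S (Suc k) *v l k) \<bullet> b)"
    by (simp add: l(1) matrix_vector_mult_sum matrix_vector_mul_assoc inner_sum_left)
  also have "\<dots> = (\<Sum>k<n. real r ^ Suc k * ((matpow R (Suc k) *v b) \<bullet> l k))"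
    unfolding S inner_matpow_transpose ..
  also have "\<dots> \<in> \<int>"
    using int[OF _ b, of "Suc _"] l(2) by (intro Ints_sum Ints_mult Ints_power) auto
  finally show ?thesis .
qed

text \<open>\<open>S\<close> is the dilation of the frequencies and \<open>T\<close> its inverse, the matrix of the two-scale
  equation.\<close>
locale hadamard_system =
  fixes R :: "real^'n^'n" and B L :: "(real^'n) set" and r :: nat and M :: "(real^'n) measure"
    and S T :: "real^'n^'n"
  assumes finite_B: "finite B" and finite_L: "finite L" and B_nonempty: "B \<noteq> {}"
    and integral: "\<And>n b l. n \<ge> 1 \<Longrightarrow> b \<in> B \<Longrightarrow> l \<in> L \<Longrightarrow> (matpow R n *v b) \<bullet> l \<in> \<int>"
    and unitary: "unitary_on B L (hadamard B)"
    and invariant: "is_invariant_measure R B r M"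
    and S_def: "S = real r *\<^sub>R transpose R"
    and T_def: "T = transpose (matrix_inv (real r *\<^sub>R R))"
    and TS: "T ** S = mat 1"
begin

sublocale prob_space M
  using invariant by (rule invariant_measureD(1))

lemma sets_M [measurable_cong]: "sets M = sets borel"
  using invariant by (rule invariant_measureD(2))

lemma T_S [simp]: "T *v (S *v x) = x"
  using TS by (simp add: matrix_vector_mul_assoc)

text \<open>The integrality hypothesis makes higher digits invisible to the symbol.\<close>
lemma chi_periodic:
  assumes "\<nu> \<in> frequencies S L n" "\<nu>' \<in> frequencies S L n'"
  shows "chi B (t + S *v \<nu> - S *v \<nu>') = chi B t"
proof -
  have "expo (t + S *v \<nu> - S *v \<nu>') b = expo t b" if "b \<in> B" for b
  proof -
    have "expo (S *v \<nu>) b = 1" "expo (S *v \<nu>') b = 1"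
      using frequencies_integral[OF integral S_def _ that] assms by (auto intro!: expo_int)
    then show ?thesis by (simp add: expo_diff expo_add)
  qed
  then show ?thesis by (simp add: chi_def)
qed

lemma zero_frequency: "0 \<in> frequencies S L 0"
  by simp

lemma ft_two_scale: "ft M t = chi B t * ft M (T *v t)"
  unfolding T_def by (rule ft_invariant_measure[OF invariant finite_B B_nonempty])

lemma chi_0 [simp]: "chi B 0 = 1"
  using finite_B B_nonempty by (simp add: chi_def)

text \<open>The symbol sees only the lowest digits, and by unitarity it separates them; dividing by \<open>S\<close>
  then exposes the next digit.\<close>
lemma digit_unique:
  assumes "l \<in> L" "l' \<in> L" "\<nu> \<in> frequencies S L n" "\<nu>' \<in> frequencies S L n"
    and eq: "l + S *v \<nu> = l' + S *v \<nu>'"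
  shows "l = l'" "\<nu> = \<nu>'"
proof -
  have "chi B (l - l') = chi B (l - l' + S *v \<nu> - S *v \<nu>')"
    using chi_periodic[OF assms(3,4)] by simp
  also have "l - l' + S *v \<nu> - S *v \<nu>' = 0" using eq by (simp add: algebra_simps)
  finally show l: "l = l'"
    using unitary_columns[OF unitary assms(1,2)] by (auto split: if_splits)
  then have "T *v (S *v \<nu>) = T *v (S *v \<nu>')" using eq by simp
  then show "\<nu> = \<nu>'" by simp
qed

lemma inj_on_digits: "inj_on (\<lambda>(l, \<nu>). l + S *v \<nu>) (L \<times> frequencies S L n)"
  using digit_unique by (fastforce simp: inj_on_def)

text \<open>At the first position where two frequencies differ, the two-scale equation has a factor that is
  an inner product of two columns of the Hadamard matrix.\<close>
lemma orthogonal: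
  assumes "l \<in> frequencies S L n" "l' \<in> frequencies S L n" "l \<noteq> l'"
  shows "ft M (l - l') = 0"
  using assms
proof (induction n arbitrary: l l')
  case (Suc n)
  obtain a \<nu> where l: "l = a + S *v \<nu>" "a \<in> L" "\<nu> \<in> frequencies S L n" using Suc.prems by auto
  obtain a' \<nu>' where l': "l' = a' + S *v \<nu>'" "a' \<in> L" "\<nu>' \<in> frequencies S L n" using Suc.prems by auto
  have d: "l - l' = (a - a') + S *v \<nu> - S *v \<nu>'" using l l' by simp
  have "chi B (l - l') = chi B (a - a')" unfolding d by (rule chi_periodic[OF l(3) l'(3)])
  also have "\<dots> = (if a = a' then 1 else 0)" by (rule unitary_columns[OF unitary l(2) l'(2)])
  finally have chi: "chi B (l - l') = (if a = a' then 1 else 0)" .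
  show ?case
  proof (cases "a = a'")
    case True
    then have "T *v (l - l') = \<nu> - \<nu>'"
      using l l' by (simp add: matrix_vector_mult_diff_distrib[symmetric])
    moreover have "\<nu> \<noteq> \<nu>'" using True l l' Suc.prems by auto
    ultimately have "ft M (T *v (l - l')) = 0" using Suc.IH l l' by simp
    then show ?thesis using ft_two_scale[of "l - l'"] by simp
  next
    case False
    then show ?thesis using ft_two_scale[of "l - l'"] chi by simp
  qed
qed simp

text \<open>Iterating the transfer operator on the squared Fourier transform unfolds the two-scale
  equation along all digit sequences at once and so produces the Bessel sums.\<close>
lemma bessel_sum_eq_transfer_iter:
  "(\<Sum>l\<in>frequencies S L n. (cmod (ft M (t - l)))\<^sup>2)
    = transfer_iter (\<lambda>t. (cmod (chi B t))\<^sup>2) ((*v) T) L (\<lambda>t. (cmod (ft M t))\<^sup>2) n t"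
proof (induction n arbitrary: t)
  case (Suc n)
  have step: "(cmod (ft M (t - (l + S *v \<nu>))))\<^sup>2
      = (cmod (chi B (t - l)))\<^sup>2 * (cmod (ft M (T *v (t - l) - \<nu>)))\<^sup>2"
    if "\<nu> \<in> frequencies S L n" for l \<nu>
  proof -
    have "chi B (t - (l + S *v \<nu>)) = chi B (t - l)"
      using chi_periodic[OF zero_frequency that, of "t - l"] by (simp add: algebra_simps)
    moreover have "T *v (t - (l + S *v \<nu>)) = T *v (t - l) - \<nu>"
      by (simp add: matrix_vector_mult_diff_distrib matrix_vector_right_distrib algebra_simps)
    ultimately show ?thesis
      using ft_two_scale[of "t - (l + S *v \<nu>)"] by (simp add: norm_mult power_mult_distrib)
  qed
  have "(\<Sum>l\<in>frequencies S L (Suc n). (cmod (ft M (t - l)))\<^sup>2)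
    = (\<Sum>(l, \<nu>)\<in>L \<times> frequencies S L n. (cmod (ft M (t - (l + S *v \<nu>))))\<^sup>2)"
    unfolding frequencies.simps by (subst sum.reindex[OF inj_on_digits]) (simp add: case_prod_unfold)
  also have "\<dots> = (\<Sum>l\<in>L. \<Sum>\<nu>\<in>frequencies S L n. (cmod (ft M (t - (l + S *v \<nu>))))\<^sup>2)"
    by (rule sum.cartesian_product[symmetric])
  also have "\<dots> = (\<Sum>l\<in>L. \<Sum>\<nu>\<in>frequencies S L n.
      (cmod (chi B (t - l)))\<^sup>2 * (cmod (ft M (T *v (t - l) - \<nu>)))\<^sup>2)"
    by (intro sum.cong refl step)
  finally show ?case using Suc by (simp add: sum_distrib_left[symmetric])
qed simp

lemma L2_inner_expo: "L2_inner M (expo s) (expo t) = ft M (s - t)"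
  by (simp add: L2_inner_def ft_def expo_diff)

lemma expo_L2_space: "expo t \<in> L2_space M"
  by (rule L2_space_bounded[where C = 1]) (auto intro: finite_measure_axioms)

lemma integrable_expo: "integrable M (expo t)"
  by (rule integrable_bounded[where C = 1]) auto

lemma ft_0 [simp]: "ft M 0 = 1"
  by (simp add: ft_def prob_space)

lemma ft_uminus: "ft M (- t) = cnj (ft M t)"
  using integrable_expo[of t] by (simp add: ft_def cnj_expo[symmetric])

text \<open>The expansion of the square is Bessel's identity for the Fourier coefficients \<open>ft M (t - l)\<close>.\<close>
lemma expo_approximation_error:
  "(LINT x|M. (cmod (expo t x - (\<Sum>l\<in>frequencies S L n. ft M (t - l) * expo l x)))\<^sup>2)
    = 1 - (\<Sum>l\<in>frequencies S L n. (cmod (ft M (t - l)))\<^sup>2)"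
proof -
  let ?F = "frequencies S L n"
  let ?c = "\<lambda>l. ft M (t - l)"
  let ?s = "complex_of_real (\<Sum>l\<in>?F. (cmod (?c l))\<^sup>2)"
  have fin: "finite ?F" using finite_L by (rule finite_frequencies)
  have sq: "?s = (\<Sum>l\<in>?F. ?c l * cnj (?c l))"
    by (simp only: of_real_sum complex_norm_square)
  have point: "complex_of_real ((cmod (expo t x - (\<Sum>l\<in>?F. ?c l * expo l x)))\<^sup>2)
      = 1 - (\<Sum>l\<in>?F. cnj (?c l) * expo (t - l) x) - (\<Sum>l\<in>?F. ?c l * expo (- (t - l)) x)
        + (\<Sum>l\<in>?F. \<Sum>l'\<in>?F. ?c l * cnj (?c l') * expo (l - l') x)" for x
  proof -
    let ?g = "\<Sum>l\<in>?F. ?c l * expo l x"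
    have "complex_of_real ((cmod (expo t x - ?g))\<^sup>2)
      = expo t x * cnj (expo t x) - expo t x * cnj ?g - ?g * cnj (expo t x) + ?g * cnj ?g"
      unfolding complex_norm_square by (simp add: algebra_simps)
    also have "expo t x * cnj (expo t x) = 1" by (simp add: expo_diff[symmetric])
    also have "expo t x * cnj ?g = (\<Sum>l\<in>?F. cnj (?c l) * expo (t - l) x)"
      by (simp add: sum_distrib_left expo_diff algebra_simps)
    also have "?g * cnj (expo t x) = (\<Sum>l\<in>?F. ?c l * expo (- (t - l)) x)"
      unfolding sum_distrib_right by (intro sum.cong refl) (simp add: expo_diff)
    also have "?g * cnj ?g = (\<Sum>l\<in>?F. \<Sum>l'\<in>?F. ?c l * cnj (?c l') * expo (l - l') x)"
      by (simp add: sum_product expo_diff algebra_simps)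
    finally show ?thesis .
  qed
  have "complex_of_real (LINT x|M. (cmod (expo t x - (\<Sum>l\<in>?F. ?c l * expo l x)))\<^sup>2)
    = (LINT x|M. 1 - (\<Sum>l\<in>?F. cnj (?c l) * expo (t - l) x) - (\<Sum>l\<in>?F. ?c l * expo (- (t - l)) x)
        + (\<Sum>l\<in>?F. \<Sum>l'\<in>?F. ?c l * cnj (?c l') * expo (l - l') x))"
    unfolding point[symmetric] by (rule integral_complex_of_real[symmetric])
  also have "\<dots> = 1 - (\<Sum>l\<in>?F. cnj (?c l) * ft M (t - l)) - (\<Sum>l\<in>?F. ?c l * ft M (- (t - l)))
        + (\<Sum>l\<in>?F. \<Sum>l'\<in>?F. ?c l * cnj (?c l') * ft M (l - l'))"
    using integrable_expo
    by (simp add: ft_def[symmetric] prob_space Bochner_Integration.integral_sum)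
  also have "(\<Sum>l\<in>?F. \<Sum>l'\<in>?F. ?c l * cnj (?c l') * ft M (l - l')) = ?s"
    unfolding sq
  proof (rule sum.cong[OF refl])
    fix l assume l: "l \<in> ?F"
    have "(\<Sum>l'\<in>?F. ?c l * cnj (?c l') * ft M (l - l'))
      = (\<Sum>l'\<in>?F. if l' = l then ?c l * cnj (?c l) else 0)"
      using orthogonal[OF l] by (intro sum.cong) auto
    then show "(\<Sum>l'\<in>?F. ?c l * cnj (?c l') * ft M (l - l')) = ?c l * cnj (?c l)"
      using fin l by simp
  qed
  also have "(\<Sum>l\<in>?F. cnj (?c l) * ft M (t - l)) = ?s"
    unfolding sq by (simp add: mult.commute)
  also have "(\<Sum>l\<in>?F. ?c l * ft M (- (t - l))) = ?s"
    unfolding sq ft_uminus ..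
  finally have "complex_of_real (LINT x|M. (cmod (expo t x - (\<Sum>l\<in>?F. ?c l * expo l x)))\<^sup>2)
    = complex_of_real (1 - (\<Sum>l\<in>?F. (cmod (?c l))\<^sup>2))" by simp
  then show ?thesis by (simp only: of_real_eq_iff)
qed

text \<open>Once the Bessel sums of the characters reach one, all characters lie in the closed span,
  and with them everything.\<close>
lemma orthonormal_basis_if_bessel:
  assumes bessel: "\<And>t. (\<lambda>n. \<Sum>l\<in>frequencies S L n. (cmod (ft M (t - l)))\<^sup>2) \<longlonglongrightarrow> 1"
    and bdd: "AE x in M. norm x \<le> K" and "0 \<in> L"
  shows "orthonormal_basis_L2 M (\<Union>n. frequencies S L n) expo"
proof -
  let ?I = "\<Union>n. frequencies S L n"
  have orth: "L2_inner M (expo i) (expo j) = (if i = j then 1 else 0)" if ij: "i \<in> ?I" "j \<in> ?I" for i j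
  proof -
    obtain m n where "i \<in> frequencies S L m" "j \<in> frequencies S L n" using ij by auto
    then have "i \<in> frequencies S L (max m n)" "j \<in> frequencies S L (max m n)"
      using frequencies_mono[OF \<open>0 \<in> L\<close>, of m "max m n" S]
        frequencies_mono[OF \<open>0 \<in> L\<close>, of n "max m n" S] by auto
    then show ?thesis using orthogonal by (auto simp: L2_inner_expo)
  qed
  have closed: "L2_closed_subspace M (L2_span_closure M ?I expo)"
    by (rule L2_closed_subspace_span_closure) (rule expo_L2_space)
  have "expo t \<in> L2_span_closure M ?I expo" for t
  proof -
    have "\<exists>F c. finite F \<and> F \<subseteq> ?I \<and> L2_norm M (\<lambda>x. expo t x - (\<Sum>i\<in>F. c i * expo i x)) < \<epsilon>"
      if \<epsilon>: "\<epsilon> > 0" for \<epsilon>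
    proof -
      have "\<forall>\<^sub>F n in sequentially. 1 - \<epsilon>\<^sup>2 < (\<Sum>l\<in>frequencies S L n. (cmod (ft M (t - l)))\<^sup>2)"
        using \<epsilon> by (intro order_tendstoD(1)[OF bessel]) simp
      then obtain n where n: "1 - \<epsilon>\<^sup>2 < (\<Sum>l\<in>frequencies S L n. (cmod (ft M (t - l)))\<^sup>2)"
        by (meson eventually_happens sequentially_bot)
      have "L2_norm M (\<lambda>x. expo t x - (\<Sum>l\<in>frequencies S L n. ft M (t - l) * expo l x)) < \<epsilon>"
        unfolding L2_norm_less_iff[OF \<epsilon>] expo_approximation_error using n by simp
      then show ?thesis
        using finite_frequencies[OF finite_L, of S n]
        by (intro exI[of _ "frequencies S L n"] exI[of _ "\<lambda>l. ft M (t - l)"]) auto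
    qed
    then show ?thesis using expo_L2_space by (simp add: L2_span_closure_def)
  qed
  then have total: "L2_space M \<subseteq> L2_span_closure M ?I expo"
    by (rule L2_closed_subspace_expo_total[OF finite_measure_axioms sets_M bdd closed])
  show ?thesis
    unfolding orthonormal_basis_L2_def
  proof (intro conjI ballI allI impI)
    fix f :: "real^'n \<Rightarrow> complex" and \<epsilon> :: real
    assume "f \<in> L2_space M" and \<epsilon>: "0 < \<epsilon>"
    then have "f \<in> L2_span_closure M ?I expo" using total by auto
    then show "\<exists>F c. finite F \<and> F \<subseteq> ?I \<and> L2_norm M (\<lambda>x. f x - (\<Sum>i\<in>F. c i * expo i x)) < \<epsilon>"
      using \<epsilon> by (rule L2_span_closureD(2))
  qed (rule expo_L2_space, rule orth)
qed

end

section \<open>Large dilations\<close>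

lemma expansive_imp_invertible:
  fixes R :: "real^'n^'n"
  assumes "expansive R"
  shows "invertible R"
proof -
  have "x = 0" if "R *v x = 0" for x
  proof (rule ccontr)
    assume "x \<noteq> 0"
    define v :: "complex^'n" where "v = (\<chi> i. complex_of_real (x $ i))"
    have "v \<noteq> 0" using \<open>x \<noteq> 0\<close> by (auto simp: v_def vec_eq_iff)
    moreover have "map_matrix complex_of_real R *v v = 0 *s v"
    proof -
      have "(map_matrix complex_of_real R *v v) $ i = complex_of_real ((R *v x) $ i)" for i
        by (simp add: v_def matrix_vector_mult_def map_matrix_def)
      then show ?thesis using that by (simp add: vec_eq_iff)
    qed
    ultimately have "is_eigenvalue R 0" unfolding is_eigenvalue_def by blast
    then show False using assms unfolding expansive_def by fastforce
  qed
  then show ?thesis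
    unfolding invertible_left_inverse matrix_left_invertible_ker by blast
qed

lemma norm_transpose_le:
  fixes A :: "real^'n^'n"
  assumes A: "\<And>x. norm (A *v x) \<le> c * norm x"
  shows "norm (transpose A *v x) \<le> c * norm x"
proof (cases "transpose A *v x = 0")
  case True
  have "0 \<le> c * norm x" using A[of x] norm_ge_zero[of "A *v x"] by linarith
  then show ?thesis using True by simp
next
  case False
  let ?y = "transpose A *v x"
  have "norm ?y * norm ?y = ?y \<bullet> ?y" by (simp add: power2_eq_square[symmetric] power2_norm_eq_inner)
  also have "\<dots> = x \<bullet> (A *v ?y)" by (simp add: transpose_matrix_vector dot_lmul_matrix)
  also have "\<dots> \<le> norm x * (c * norm ?y)"
    using norm_cauchy_schwarz[of x "A *v ?y"] mult_left_mono[OF A[of ?y], of "norm x"] by simp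
  finally have "norm ?y * norm ?y \<le> (c * norm x) * norm ?y" by (simp add: algebra_simps)
  then show ?thesis using False by simp
qed

lemma matrix_inv_inverse:
  assumes "invertible A"
  shows "A ** matrix_inv A = mat 1" "matrix_inv A ** A = mat 1"
  using someI_ex[OF assms[unfolded invertible_def]] unfolding matrix_inv_def by auto

lemma scaled_inverse_bound:
  fixes R :: "real^'n^'n"
  assumes inv: "invertible R" and K: "\<And>x. norm (matrix_inv R *v x) \<le> K * norm x" and r: "0 < r"
  shows "invertible (r *\<^sub>R R)" "norm (matrix_inv (r *\<^sub>R R) *v x) \<le> K / r * norm x"
proof -
  have "(r *\<^sub>R R) ** ((1 / r) *\<^sub>R matrix_inv R) = mat 1"
    "((1 / r) *\<^sub>R matrix_inv R) ** (r *\<^sub>R R) = mat 1"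
    using r matrix_inv_inverse[OF inv]
    by (simp_all add: matrix_scalar_ac scalar_matrix_assoc[symmetric])
  then show I: "invertible (r *\<^sub>R R)" unfolding invertible_def by blast
  let ?y = "matrix_inv (r *\<^sub>R R) *v x"
  have "(r *\<^sub>R R) *v ?y = x" using matrix_inv_inverse[OF I] by (simp add: matrix_vector_mul_assoc)
  then have "x = r *\<^sub>R (R *v ?y)" by (simp add: scaleR_matrix_vector_assoc)
  then have "matrix_inv R *v x = r *\<^sub>R (matrix_inv R *v (R *v ?y))"
    by (metis matrix_vector_mult_scaleR)
  also have "matrix_inv R *v (R *v ?y) = ?y"
    using matrix_inv_inverse[OF inv] by (simp add: matrix_vector_mul_assoc matrix_mul_assoc)
  finally have "r * norm ?y = norm (matrix_inv R *v x)" using r by simp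
  then have "r * norm ?y \<le> K * norm x" using K[of x] by simp
  then show "norm ?y \<le> K / r * norm x" using r by (simp add: field_simps)
qed

lemma finite_norm_bound:
  assumes "finite A"
  obtains \<beta> where "0 \<le> \<beta>" "\<And>a. a \<in> A \<Longrightarrow> norm a \<le> (\<beta> :: real)"
proof (rule that[of "\<Sum>a\<in>A. norm a"])
  show "norm a \<le> (\<Sum>a\<in>A. norm a)" if "a \<in> A" for a
    using member_le_sum[OF that, of norm] assms by simp
qed (simp add: sum_nonneg)

theorem corollary3p3:
  fixes R :: "real^'d^'d" and B L :: "(real^'d) set"
  assumes "expansive R"
    and "finite B" and "finite L" and "card B = card L"
    and "\<And>n b l. n \<ge> 1 \<Longrightarrow> b \<in> B \<Longrightarrow> l \<in> L \<Longrightarrow> (matpow R n *v b) \<bullet> l \<in> \<int>"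
    and "unitary_on B L (hadamard B)"
    and "span L = UNIV" and "0 \<in> L"
  shows "\<exists>r0\<ge>1. \<forall>r\<ge>r0. orthonormal_basis_L2 (mu R B r) (spectrum_set R L r) expo"
proof -
  have B_nonempty: "B \<noteq> {}" using assms(2,3,4,8) by auto
  have inv: "invertible R" using assms(1) by (rule expansive_imp_invertible)
  obtain K where K: "0 < K" "\<And>x. norm (matrix_inv R *v x) \<le> K * norm x"
    using bounded_linear.pos_bounded[of "(*v) (matrix_inv R)"]
    by (auto simp: linear_linear[symmetric] matrix_vector_mul_linear mult.commute)
  obtain \<beta> where \<beta>: "0 \<le> \<beta>" "\<And>b. b \<in> B \<Longrightarrow> norm b \<le> \<beta>"
    using finite_norm_bound[OF assms(2)] by blast
  obtain m where m: "0 \<le> m" "\<And>l. l \<in> L \<Longrightarrow> norm l \<le> m"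
    using finite_norm_bound[OF assms(3)] by blast
  \<comment> \<open>Dilations with contraction rate at most \<open>1/2\<close> have invariant measures supported in the
    ball of radius \<open>2 * \<beta>\<close>. This fixes \<open>\<kappa>\<close> and \<open>\<rho>\<close> before \<open>r\<close> is chosen.\<close>
  define \<kappa> where "\<kappa> = 4 * pi * (2 * \<beta>)"
  define \<rho> where "\<rho> = 1 / (2 * (\<kappa> + 1))"
  have \<kappa>: "0 \<le> \<kappa>" using \<beta> by (simp add: \<kappa>_def)
  have \<rho>: "0 < \<rho>" "\<kappa> * \<rho> \<le> 1 / 2" using \<kappa> by (auto simp: \<rho>_def field_simps)
  \<comment> \<open>Beyond this bound every branch maps the ball of radius \<open>2 * \<rho>\<close> into that of radius \<open>\<rho>\<close>.\<close>
  define r0 where "r0 = nat \<lceil>K * (2 * \<rho> + m) / \<rho>\<rceil> + 1"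
  have "orthonormal_basis_L2 (mu R B r) (spectrum_set R L r) expo" if r: "r \<ge> r0" for r
  proof -
    have r_pos: "0 < real r" using r by (simp add: r0_def)
    have "K * (2 * \<rho> + m) / \<rho> \<le> real r"
      using r unfolding r0_def by linarith
    then have "K * (2 * \<rho> + m) \<le> \<rho> * real r" using \<rho>(1) by (simp add: pos_divide_le_eq mult.commute)
    define c where "c = K / real r"
    have c0: "0 \<le> c" using K r_pos by (simp add: c_def)
    have c_small: "c * (2 * \<rho> + m) \<le> \<rho>"
      using \<open>K * (2 * \<rho> + m) \<le> \<rho> * real r\<close> r_pos by (simp add: c_def pos_divide_le_eq)
    have c_half: "c \<le> 1 / 2"
    proof -
      have "c * (2 * \<rho>) \<le> c * (2 * \<rho> + m)" using c0 m by (intro mult_left_mono) auto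
      also have "\<dots> \<le> \<rho>" by (rule c_small)
      finally have "(2 * c) * \<rho> \<le> 1 * \<rho>" by (simp add: algebra_simps)
      then have "2 * c \<le> 1" by (rule mult_right_le_imp_le[OF _ \<rho>(1)])
      then show ?thesis by simp
    qed
    then have c1: "c < 1" by simp
    have contr: "norm (matrix_inv (real r *\<^sub>R R) *v x) \<le> c * norm x" for x
      unfolding c_def by (rule scaled_inverse_bound(2)[OF inv K(2) r_pos])
    note mu = invariant_measure_mu[OF assms(2) B_nonempty c0 c1 contr \<beta>(2)]
    let ?M = "mu R B r"
    have "\<beta> / (1 - c) \<le> 2 * \<beta>"
    proof -
      have "\<beta> * 1 \<le> \<beta> * (2 * (1 - c))" using \<beta>(1) c_half by (intro mult_left_mono) auto
      then show ?thesis using c1 by (simp add: pos_divide_le_eq algebra_simps)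
    qed
    then have bdd: "AE x in ?M. norm x \<le> 2 * \<beta>" using mu(2) by auto
    let ?S = "real r *\<^sub>R transpose R"
    let ?T = "transpose (matrix_inv (real r *\<^sub>R R))"
    have "?T ** ?S = mat 1"
    proof -
      have "?S = transpose (real r *\<^sub>R R)" by (simp add: transpose_def vec_eq_iff)
      then have "?T ** ?S = transpose ((real r *\<^sub>R R) ** matrix_inv (real r *\<^sub>R R))"
        by (simp add: matrix_transpose_mul)
      then show ?thesis
        using matrix_inv_inverse(1)[OF scaled_inverse_bound(1)[OF inv K(2) r_pos]] by (simp add: transpose_mat)
    qed
    then interpret hadamard_system R B L r ?M ?S ?T
      using assms(2,3,5,6) B_nonempty mu(1) by unfold_locales auto
    have "(\<lambda>n. \<Sum>l\<in>frequencies ?S L n. (cmod (ft ?M (t - l)))\<^sup>2) \<longlonglongrightarrow> 1" for t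
      unfolding bessel_sum_eq_transfer_iter
    proof (rule transfer_iter_tendsto_1[OF assms(3,8) m(2), where \<kappa> = \<kappa> and c = c and \<rho> = \<rho>])
      show "(\<Sum>l\<in>L. (cmod (chi B (t - l)))\<^sup>2) = 1" for t
        by (rule sum_chi_sq[OF assms(6,2) B_nonempty])
      show "(cmod (ft ?M t))\<^sup>2 \<le> 1" for t
        using ft_bounds(1)[OF prob_space_axioms sets_M bdd, of t] by (simp add: power_le_one)
      show "(cmod (ft ?M t))\<^sup>2 = (cmod (chi B t))\<^sup>2 * (cmod (ft ?M (?T *v t)))\<^sup>2" for t
        by (subst ft_two_scale) (simp add: norm_mult power_mult_distrib)
      show "1 - (cmod (ft ?M t))\<^sup>2 \<le> \<kappa> * norm t" for t
        using ft_bounds(2)[OF prob_space_axioms sets_M bdd, of t] by (simp add: \<kappa>_def)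
      show "norm (?T *v x) \<le> c * norm x" for x
        by (rule norm_transpose_le[OF contr])
    qed (use \<kappa> c0 \<rho> c_small in auto)
    then show ?thesis
      unfolding spectrum_set_eq_frequencies[OF assms(8)]
      by (rule orthonormal_basis_if_bessel[OF _ bdd assms(8)])
  qed
  then show ?thesis by (intro exI[of _ r0]) (auto simp: r0_def)
qed

end
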